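(* Assume $s\log p/n=o(1)$ and that the rows are uniformly sub-Gaussian (there is a universal constant $K$ with $\sup_{\|\alpha\|_2\le1}\mathbb E\exp(|\alpha^TX_i|^2/K^2)\le2$ for all $i$). Let $\tau>0$ and let $\hat T=\hat\Theta+\hat\Theta^T-\hat\Theta^T\hat\Sigma\hat\Theta$ where $\hat\Theta$ is the nodewise Lasso estimator with $\lambda_j\ge c\tau\sqrt{\log p/n}$ uniformly in $j$, for some sufficiently large constant $c>0$. Then there exist constants $C_\tau,c_1,c_2>0$ such that for every $(i,j)$ $$\sup_{\Theta_0\in\mathcal G(s)}\mathbb P\Big(|\hat T_{ij}-\Theta^0_{ij}|\ge C_\tau\max\Big\{\frac1{\sqrt n},\,s\frac{\log p}{n}\Big\}\Big)\le c_1e^{-c_2\tau}$$ and $$\sup_{\Theta_0\in\mathcal G(s)}\mathbb P\Big(\|\hat T-\Theta_0\|_\infty\ge C_\tau\max\Big\{\sqrt{\frac{\log p}{n}},\,s\frac{\log p}{n}\Big\}\Big)\le c_1p^{1-c_2\tau}.$$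
   Context: Setting: $\mathbf X$ is an $n\times p$ matrix whose rows $X_1,\dots,X_n$ are i.i.d. with mean zero and invertible covariance $\Sigma_0$, $\Theta_0=\Sigma_0^{-1}$ with columns $\Theta^0_j$ and entries $\Theta^0_{ij}$. $\hat\Sigma=\mathbf X^T\mathbf X/n$. Nodewise Lasso: $\hat\gamma_j=\arg\min_{\gamma\in\mathbb R^{p-1}}\|X_j-\mathbf X_{-j}\gamma\|_2^2/n+2\lambda_j\|\gamma\|_1$ ($X_j$ the $j$-th column, $\mathbf X_{-j}$ the remaining columns); $\hat\Gamma_j\in\mathbb R^p$ has $j$-th entry $1$ and $k$-th entry $-\hat\gamma_{j,k}$ ($k\ne j$); $\hat\tau_j^2=\|X_j-\mathbf X_{-j}\hat\gamma_j\|_2^2/n+\lambda_j\|\hat\gamma_j\|_1$; $\hat\Theta_j=\hat\Gamma_j/\hat\tau_j^2$. $s=\max_j\|\Theta^0_j\|_0$. $\|A\|_\infty=\max_{i,j}|A_{ij}|$. $\mathcal G(s)=\{\Theta:\max_i\|\Theta_i\|_0\le s,\ 1/L\le\Lambda_{\min}(\Theta)\le\Lambda_{\max}(\Theta)\le L\}$ for a universal $L\ge1$.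
   Formalization: The tuning parameters are also bounded above, λ_j ≤ c'τ√(log p/n) for an arbitrary constant c' ≥ c on which the other constants may depend; with only the lower bound, a huge λ_j forces zero nodewise fits and makes the off-diagonal entries of T̂ inconsistent. *)

theory Defs
  imports "HOL-Probability.Probability"
begin

text \<open>Data: an n x p matrix x (row r, column j = x r j), indices r < n, j < p.\<close>

definition Sigma_hat :: "nat \<Rightarrow> (nat \<Rightarrow> nat \<Rightarrow> real) \<Rightarrow> nat \<Rightarrow> nat \<Rightarrow> real" where
  "Sigma_hat n x a b = (\<Sum>r<n. x r a * x r b) / real n"

text \<open>gamma in R^(p-1) is represented as a function on the index set {..<p} - {j}.\<close>
definition resid_sq :: "nat \<Rightarrow> nat \<Rightarrow> (nat \<Rightarrow> nat \<Rightarrow> real) \<Rightarrow> nat \<Rightarrow> (nat \<Rightarrow> real) \<Rightarrow> real" where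
  "resid_sq n p x j \<gamma> = (\<Sum>r<n. (x r j - (\<Sum>k\<in>{..<p} - {j}. x r k * \<gamma> k))\<^sup>2) / real n"

definition l1_off :: "nat \<Rightarrow> nat \<Rightarrow> (nat \<Rightarrow> real) \<Rightarrow> real" where
  "l1_off p j \<gamma> = (\<Sum>k\<in>{..<p} - {j}. \<bar>\<gamma> k\<bar>)"

definition lasso_obj :: "nat \<Rightarrow> nat \<Rightarrow> (nat \<Rightarrow> nat \<Rightarrow> real) \<Rightarrow> nat \<Rightarrow> real \<Rightarrow> (nat \<Rightarrow> real) \<Rightarrow> real" where
  "lasso_obj n p x j lam \<gamma> = resid_sq n p x j \<gamma> + 2 * lam * l1_off p j \<gamma>"

definition is_nodewise_lasso :: "nat \<Rightarrow> nat \<Rightarrow> (nat \<Rightarrow> nat \<Rightarrow> real) \<Rightarrow> nat \<Rightarrow> real \<Rightarrow> (nat \<Rightarrow> real) \<Rightarrow> bool" where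
  "is_nodewise_lasso n p x j lam \<gamma> \<longleftrightarrow> (\<forall>\<gamma>'. lasso_obj n p x j lam \<gamma> \<le> lasso_obj n p x j lam \<gamma>')"

definition Gamma_hat :: "nat \<Rightarrow> (nat \<Rightarrow> real) \<Rightarrow> nat \<Rightarrow> real" where
  "Gamma_hat j \<gamma> i = (if i = j then 1 else - \<gamma> i)"

definition tau_hat_sq :: "nat \<Rightarrow> nat \<Rightarrow> (nat \<Rightarrow> nat \<Rightarrow> real) \<Rightarrow> nat \<Rightarrow> real \<Rightarrow> (nat \<Rightarrow> real) \<Rightarrow> real" where
  "tau_hat_sq n p x j lam \<gamma> = resid_sq n p x j \<gamma> + lam * l1_off p j \<gamma>"

text \<open>Theta_hat i j = i-th entry of column j; g j is gamma_hat_j, lam j is lambda_j.\<close>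
definition Theta_hat :: "nat \<Rightarrow> nat \<Rightarrow> (nat \<Rightarrow> nat \<Rightarrow> real) \<Rightarrow> (nat \<Rightarrow> real) \<Rightarrow> (nat \<Rightarrow> nat \<Rightarrow> real) \<Rightarrow> nat \<Rightarrow> nat \<Rightarrow> real" where
  "Theta_hat n p x lam g i j = Gamma_hat j (g j) i / tau_hat_sq n p x j (lam j) (g j)"

definition T_hat :: "nat \<Rightarrow> nat \<Rightarrow> (nat \<Rightarrow> nat \<Rightarrow> real) \<Rightarrow> (nat \<Rightarrow> real) \<Rightarrow> (nat \<Rightarrow> nat \<Rightarrow> real) \<Rightarrow> nat \<Rightarrow> nat \<Rightarrow> real" where
  "T_hat n p x lam g a b = Theta_hat n p x lam g a b + Theta_hat n p x lam g b a
     - (\<Sum>k<p. \<Sum>l<p. Theta_hat n p x lam g k a * Sigma_hat n x k l * Theta_hat n p x lam g l b)"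

definition max_abs_norm :: "nat \<Rightarrow> (nat \<Rightarrow> nat \<Rightarrow> real) \<Rightarrow> real" where
  "max_abs_norm p A = Max {\<bar>A a b\<bar> | a b. a < p \<and> b < p}"

definition mat_eigenvalues :: "nat \<Rightarrow> (nat \<Rightarrow> nat \<Rightarrow> real) \<Rightarrow> real set" where
  "mat_eigenvalues p A = {\<mu>. \<exists>v. (\<exists>k<p. v k \<noteq> 0) \<and> (\<forall>i<p. (\<Sum>k<p. A i k * v k) = \<mu> * v i)}"

definition lambda_min :: "nat \<Rightarrow> (nat \<Rightarrow> nat \<Rightarrow> real) \<Rightarrow> real" where
  "lambda_min p A = Inf (mat_eigenvalues p A)"

definition lambda_max :: "nat \<Rightarrow> (nat \<Rightarrow> nat \<Rightarrow> real) \<Rightarrow> real" where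
  "lambda_max p A = Sup (mat_eigenvalues p A)"

definition in_G :: "nat \<Rightarrow> real \<Rightarrow> nat \<Rightarrow> (nat \<Rightarrow> nat \<Rightarrow> real) \<Rightarrow> bool" where
  "in_G p L s \<Theta> \<longleftrightarrow> (\<forall>i<p. card {k. k < p \<and> \<Theta> k i \<noteq> 0} \<le> s)
      \<and> 1 / L \<le> lambda_min p \<Theta> \<and> lambda_min p \<Theta> \<le> lambda_max p \<Theta> \<and> lambda_max p \<Theta> \<le> L"

definition data_measure :: "nat \<Rightarrow> (nat \<Rightarrow> real) measure \<Rightarrow> (nat \<Rightarrow> nat \<Rightarrow> real) measure" where
  "data_measure n \<mu> = PiM {..<n} (\<lambda>_. \<mu>)"

definition outer_prob_le :: "'a measure \<Rightarrow> 'a set \<Rightarrow> real \<Rightarrow> bool" where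
  "outer_prob_le M A r \<longleftrightarrow> (\<exists>B\<in>sets M. A \<subseteq> B \<and> measure M B \<le> r)"

end

theory Submission
  imports Defs
begin

text \<open>
  Write \<open>\<Delta> = \<Sigma>_hat - \<Sigma>0\<close>, let \<open>\<theta>_j\<close> be the columns of \<open>\<Theta>0\<close> and \<open>d_j\<close> the column errors of the nodewise
  Lasso. Since \<open>\<Sigma>0 \<Theta>0 = I\<close>, the terms linear in \<open>d_i\<close>, \<open>d_j\<close> that do not involve \<open>\<Delta>\<close> cancel:
  \<open>T_ij - \<Theta>0_ij = - \<theta>_i' \<Delta> \<theta>_j - d_i' \<Delta> \<theta>_j - d_j' \<Delta> \<theta>_i - d_i' \<Sigma>_hat d_j\<close>.
  The last three terms are of order \<open>s log p / n\<close> by the Lasso oracle inequality for \<open>d_j\<close> and a uniform bound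
  on the entries of \<open>\<Delta> \<Theta>0\<close>, while the first is an average of centred subexponential variables and is
  treated by Bernstein's inequality.

  As only \<open>s log p / n\<close> is small, the entrywise bound on \<open>\<Delta>\<close> does not give the restricted
  eigenvalue condition. Instead \<open>\<Delta>\<close> is controlled on a net of sparse unit vectors
  and the bound is extended to the cone \<open>\<parallel>v\<parallel>\<^sub>1 \<le> 4 sqrt s \<parallel>v\<parallel>\<^sub>2\<close> by shelling. For \<open>\<tau> < 1\<close> both probability
  bounds exceed 1 once \<open>c1 = 8\<close> and \<open>c2 = 1\<close>.
\<close>

subsection \<open>Bernstein's inequality\<close>

text \<open>Randomness enters only through the forms of \<open>Sigma_hat\<close> minus
  \<open>\<Sigma>0\<close> at finitely many fixed pairs of vectors; outside the corresponding bad
  events everything is deterministic. This separation matters because the minimisers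
  \<open>g\<close> are an arbitrary selection, so events about \<open>T_hat\<close> need not be
  measurable and are only covered by measurable bad sets. Deviation levels are proportional to
  \<tau>. The Bernstein exponent has a quadratic and a linear branch, and for \<tau> \<ge> 1 both
  are at least linear in \<tau>; this produces the decay in \<tau> and explains the split at \<tau>
  = 1. Smallness of s log p / n pays for the entropy of the net, of order s log p against an
  exponent of order n, and keeps the normalisers \<open>tau_hat_sq\<close> away from zero. The two
  bounds differ in the leading term alone: one fixed pair (i,j) fluctuates at the level 1 / sqrt n,
  while a union over all p^2 pairs costs sqrt (log p / n).\<close>

lemma exp_le_one_plus_quadratic:
  fixes x :: real
  shows "exp x \<le> 1 + x + x\<^sup>2 / 2 * exp \<bar>x\<bar>"
proof -
  obtain t where t: "\<bar>t\<bar> \<le> \<bar>x\<bar>" "exp x = (\<Sum>m<2. x ^ m / fact m) + exp t / fact 2 * x ^ 2"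
    using Maclaurin_exp_le[of x 2] by blast
  have "exp t * x\<^sup>2 \<le> exp \<bar>x\<bar> * x\<^sup>2"
    using t(1) by (intro mult_right_mono) auto
  then show ?thesis
    using t(2) by (simp add: eval_nat_numeral mult_ac)
qed

text \<open>The restriction on \<open>l\<close> spends only half of the available exponential
  moment: with u = |Y| / (2B) one has |l Y| \<le> u, and the other factor exp u absorbs the square
  through u^2 \<le> 2 exp u. The remainder is then a multiple of exp (|Y| / B), whose mean is at
  most 2.\<close>

lemma (in prob_space) mgf_centered_le:
  fixes Y :: "'a \<Rightarrow> real"
  assumes Y: "integrable M Y" and B: "B > 0"
    and psi1: "(\<integral>\<^sup>+x. ennreal (exp (\<bar>Y x\<bar> / B)) \<partial>M) \<le> 2"
    and l: "\<bar>l\<bar> \<le> 1 / (2 * B)"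
  shows "(\<integral>\<^sup>+x. ennreal (exp (l * (Y x - expectation Y))) \<partial>M) \<le> ennreal (exp (8 * l\<^sup>2 * B\<^sup>2))"
proof -
  have [measurable]: "Y \<in> borel_measurable M" using Y by auto
  define e where "e x = exp (\<bar>Y x\<bar> / B)" for x
  have e_fin: "(\<integral>\<^sup>+x. ennreal (norm (e x)) \<partial>M) < \<infinity>"
    using order.strict_trans1[OF psi1, of \<infinity>] by (simp add: e_def)
  have e_int: "integrable M e"
    by (rule integrableI_bounded[OF _ e_fin]) (simp add: e_def)
  have "ennreal (expectation e) = (\<integral>\<^sup>+x. ennreal (e x) \<partial>M)"
    using e_int by (intro nn_integral_eq_integral[symmetric]) (auto simp: e_def)
  also have "\<dots> \<le> ennreal 2" using psi1 by (simp add: e_def)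
  finally have e_le: "expectation e \<le> 2" by (subst (asm) ennreal_le_iff) auto
  have pt: "exp (l * Y x) \<le> 1 + l * Y x + 4 * l\<^sup>2 * B\<^sup>2 * e x" for x
  proof -
    define u where "u = \<bar>Y x\<bar> / (2 * B)"
    have u0: "u \<ge> 0" using B by (simp add: u_def)
    have Yu: "\<bar>Y x\<bar> = 2 * B * u" using B by (simp add: u_def)
    have "u\<^sup>2 / 2 \<le> exp u" using exp_lower_Taylor_quadratic[OF u0] u0 by linarith
    then have u2: "u\<^sup>2 \<le> 2 * exp u" by simp
    have "\<bar>l * Y x\<bar> \<le> u"
      using mult_right_mono[OF l, of "\<bar>Y x\<bar>"] by (simp add: abs_mult u_def)
    then have "(l * Y x)\<^sup>2 / 2 * exp \<bar>l * Y x\<bar> \<le> (l * Y x)\<^sup>2 / 2 * exp u"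
      by (intro mult_left_mono) auto
    also have "(l * Y x)\<^sup>2 / 2 * exp u = l\<^sup>2 * (4 * B\<^sup>2 * u\<^sup>2) / 2 * exp u"
      using arg_cong[OF Yu, of "\<lambda>z. z\<^sup>2"] by (simp add: power_mult_distrib)
    also have "l\<^sup>2 * (4 * B\<^sup>2 * u\<^sup>2) / 2 * exp u \<le> l\<^sup>2 * (4 * B\<^sup>2 * (2 * exp u)) / 2 * exp u"
      using u2 by (intro mult_right_mono divide_right_mono mult_left_mono) auto
    also have "\<dots> = 4 * l\<^sup>2 * B\<^sup>2 * (exp u * exp u)" by simp
    also have "exp u * exp u = e x"
      using B by (simp add: e_def Yu flip: exp_add)
    finally have "(l * Y x)\<^sup>2 / 2 * exp \<bar>l * Y x\<bar> \<le> 4 * l\<^sup>2 * B\<^sup>2 * e x" .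
    then show ?thesis
      using exp_le_one_plus_quadratic[of "l * Y x"] by linarith
  qed
  have rhs_int: "integrable M (\<lambda>x. 1 + l * Y x + 4 * l\<^sup>2 * B\<^sup>2 * e x)"
    using Y e_int by auto
  have exp_int: "integrable M (\<lambda>x. exp (l * Y x))"
    by (rule Bochner_Integration.integrable_bound[OF rhs_int]) (use pt in \<open>auto intro: order_trans[OF _ abs_ge_self]\<close>)
  have "expectation (\<lambda>x. exp (l * Y x)) \<le> expectation (\<lambda>x. 1 + l * Y x + 4 * l\<^sup>2 * B\<^sup>2 * e x)"
    by (rule integral_mono[OF exp_int rhs_int]) (rule pt)
  also have "\<dots> = 1 + l * expectation Y + 4 * l\<^sup>2 * B\<^sup>2 * expectation e"
    using Y e_int by (simp add: prob_space)
  also have "\<dots> \<le> 1 + (l * expectation Y + 8 * l\<^sup>2 * B\<^sup>2)"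
    using mult_left_mono[OF e_le, of "4 * l\<^sup>2 * B\<^sup>2"] by simp
  \<comment> \<open>The mean stays inside the exponent here, so that centring amounts to
    multiplication by exp (- l E Y).\<close>
  also have "\<dots> \<le> exp (l * expectation Y + 8 * l\<^sup>2 * B\<^sup>2)" by (rule exp_ge_add_one_self)
  finally have "expectation (\<lambda>x. exp (l * Y x)) * exp (- (l * expectation Y))
      \<le> exp (l * expectation Y + 8 * l\<^sup>2 * B\<^sup>2) * exp (- (l * expectation Y))"
    by (intro mult_right_mono) auto
  then have *: "expectation (\<lambda>x. exp (l * Y x)) * exp (- (l * expectation Y)) \<le> exp (8 * l\<^sup>2 * B\<^sup>2)"
    by (simp flip: exp_add)
  have eq: "exp (l * (Y x - expectation Y)) = exp (l * Y x) * exp (- (l * expectation Y))" for x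
    by (simp add: right_diff_distrib flip: exp_add)
  have "(\<integral>\<^sup>+x. ennreal (exp (l * (Y x - expectation Y))) \<partial>M)
      = ennreal (expectation (\<lambda>x. exp (l * Y x) * exp (- (l * expectation Y))))"
    unfolding eq using exp_int by (intro nn_integral_eq_integral) auto
  also have "\<dots> \<le> ennreal (exp (8 * l\<^sup>2 * B\<^sup>2))"
    using * exp_int by simp
  finally show ?thesis .
qed

text \<open>Exponential Markov inequality: the integral of the product factorises over the rows. The
  sign of \<open>l\<close> is left free so that one statement serves both tails.\<close>

lemma (in prob_space) chernoff_iid:
  fixes Y :: "'a \<Rightarrow> real"
  assumes Y: "integrable M Y" and B: "B > 0"
    and psi1: "(\<integral>\<^sup>+x. ennreal (exp (\<bar>Y x\<bar> / B)) \<partial>M) \<le> 2"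
    and l: "\<bar>l\<bar> \<le> 1 / (2 * B)"
  shows "measure (PiM {..<n} (\<lambda>_. M))
      {x \<in> space (PiM {..<n} (\<lambda>_. M)). (\<Sum>r<n. l * (Y (x r) - expectation Y)) \<ge> c}
      \<le> exp (real n * (8 * l\<^sup>2 * B\<^sup>2) - c)"
proof -
  have [measurable]: "Y \<in> borel_measurable M" using Y by auto
  interpret P: product_prob_space "\<lambda>_. M" "{..<n}" by unfold_locales
  have fin: "finite_measure (PiM {..<n} (\<lambda>_. M))"
    by (intro prob_space.axioms(1) prob_space_PiM) (rule prob_space_axioms)
  let ?P = "PiM {..<n} (\<lambda>_. M)"
  define f where "f x = ennreal (exp (l * (Y x - expectation Y)))" for x
  have [measurable]: "f \<in> borel_measurable M" unfolding f_def by measurable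
  have prod_eq: "(\<Prod>r<n. f (x r)) = ennreal (exp (\<Sum>r<n. l * (Y (x r) - expectation Y)))" for x
    by (simp add: f_def prod_ennreal exp_sum)
  have meas: "(\<lambda>x. \<Prod>r<n. f (x r)) \<in> borel_measurable ?P" by measurable
  have "emeasure ?P {x \<in> space ?P. (\<Sum>r<n. l * (Y (x r) - expectation Y)) \<ge> c}
      \<le> emeasure ?P {x \<in> space ?P. 1 \<le> ennreal (exp (- c)) * (\<Prod>r<n. f (x r))}"
  proof (rule emeasure_mono)
    show "{x \<in> space ?P. (\<Sum>r<n. l * (Y (x r) - expectation Y)) \<ge> c}
        \<subseteq> {x \<in> space ?P. 1 \<le> ennreal (exp (- c)) * (\<Prod>r<n. f (x r))}"
      by (auto simp: prod_eq simp flip: ennreal_mult exp_add)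
    show "{x \<in> space ?P. 1 \<le> ennreal (exp (- c)) * (\<Prod>r<n. f (x r))} \<in> sets ?P"
      using meas by measurable
  qed
  also have "\<dots> \<le> ennreal (exp (- c)) * (\<integral>\<^sup>+x. (\<Prod>r<n. f (x r)) \<partial>?P)"
    using nn_integral_Markov_inequality[of "\<lambda>x. \<Prod>r<n. f (x r)" "space ?P" ?P "ennreal (exp (- c))"] meas
    by (simp cong: nn_integral_cong)
  also have "(\<integral>\<^sup>+x. (\<Prod>r<n. f (x r)) \<partial>?P) = (\<Prod>r<n. \<integral>\<^sup>+x. f x \<partial>M)"
    by (rule P.product_nn_integral_prod) auto
  also have "\<dots> \<le> (\<Prod>r<n. ennreal (exp (8 * l\<^sup>2 * B\<^sup>2)))"
    unfolding f_def using mgf_centered_le[OF Y B psi1 l]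
    by (simp add: power_mono)
  also have "\<dots> = ennreal (exp (real n * (8 * l\<^sup>2 * B\<^sup>2)))"
    by (simp add: ennreal_power exp_of_nat_mult)
  finally have "emeasure ?P {x \<in> space ?P. (\<Sum>r<n. l * (Y (x r) - expectation Y)) \<ge> c}
      \<le> ennreal (exp (- c)) * ennreal (exp (real n * (8 * l\<^sup>2 * B\<^sup>2)))"
    by (simp add: mult_left_mono)
  also have "\<dots> = ennreal (exp (real n * (8 * l\<^sup>2 * B\<^sup>2) - c))"
    by (simp flip: ennreal_mult exp_add)
  finally show ?thesis
    by (simp add: finite_measure.emeasure_eq_measure[OF fin])
qed

text \<open>The quadratic in \<open>l\<close> is minimal at t / (16 B^2). This point is admissible
  exactly for t \<le> 8 B and gives the Gaussian branch; otherwise the endpoint 1 / (2 B) gives the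
  exponential branch.\<close>

lemma bernstein_rate:
  fixes B t :: real
  assumes "B > 0" "t > 0"
  obtains l where "0 < l" "l \<le> 1 / (2 * B)" "8 * l\<^sup>2 * B\<^sup>2 - l * t \<le> - min (t\<^sup>2 / (32 * B\<^sup>2)) (t / (4 * B))"
proof (cases "t \<le> 8 * B")
  case True
  have "8 * (t / (16 * B\<^sup>2))\<^sup>2 * B\<^sup>2 - t / (16 * B\<^sup>2) * t = - (t\<^sup>2 / (32 * B\<^sup>2))"
    using assms by (simp add: field_simps power2_eq_square)
  moreover have "t / (16 * B\<^sup>2) \<le> 1 / (2 * B)" using True assms by (simp add: field_simps power2_eq_square)
  ultimately show ?thesis using that[of "t / (16 * B\<^sup>2)"] assms by simp
next
  case False
  have "8 * (1 / (2 * B))\<^sup>2 * B\<^sup>2 - 1 / (2 * B) * t \<le> - (t / (4 * B))"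
    using assms False by (simp add: field_simps power2_eq_square)
  then show ?thesis using that[of "1 / (2 * B)"] assms by simp
qed

lemma (in prob_space) bernstein_iid:
  fixes Y :: "'a \<Rightarrow> real"
  assumes Y: "integrable M Y" and B: "B > 0"
    and psi1: "(\<integral>\<^sup>+x. ennreal (exp (\<bar>Y x\<bar> / B)) \<partial>M) \<le> 2"
    and t: "t > 0" and n: "n \<ge> 1"
  shows "measure (PiM {..<n} (\<lambda>_. M))
      {x \<in> space (PiM {..<n} (\<lambda>_. M)). \<bar>(\<Sum>r<n. Y (x r)) / real n - expectation Y\<bar> \<ge> t}
      \<le> 2 * exp (- real n * min (t\<^sup>2 / (32 * B\<^sup>2)) (t / (4 * B)))"
proof -
  have [measurable]: "Y \<in> borel_measurable M" using Y by auto
  have fin: "finite_measure (PiM {..<n} (\<lambda>_. M))"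
    by (intro prob_space.axioms(1) prob_space_PiM) (rule prob_space_axioms)
  let ?P = "PiM {..<n} (\<lambda>_. M)"
  define r where "r = min (t\<^sup>2 / (32 * B\<^sup>2)) (t / (4 * B))"
  obtain l where l: "0 < l" "l \<le> 1 / (2 * B)" "8 * l\<^sup>2 * B\<^sup>2 - l * t \<le> - r"
    using bernstein_rate[OF B t] unfolding r_def by blast
  let ?E = "\<lambda>l. {x \<in> space ?P. (\<Sum>r<n. l * (Y (x r) - expectation Y)) \<ge> real n * \<bar>l\<bar> * t}"
  have E: "measure ?P (?E l') \<le> exp (- real n * r)" if "\<bar>l'\<bar> = l" for l'
  proof -
    have "measure ?P (?E l') \<le> exp (real n * (8 * l'\<^sup>2 * B\<^sup>2) - real n * \<bar>l'\<bar> * t)"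
      using chernoff_iid[OF Y B psi1, of l'] l that by simp
    also have "l'\<^sup>2 = l\<^sup>2" using that by auto
    also have "real n * (8 * l\<^sup>2 * B\<^sup>2) - real n * \<bar>l'\<bar> * t = real n * (8 * l\<^sup>2 * B\<^sup>2 - l * t)"
      using that by (simp add: algebra_simps)
    also have "\<dots> \<le> real n * (- r)" using l(3) by (intro mult_left_mono) auto
    finally show ?thesis by simp
  qed
  have sub: "{x \<in> space ?P. \<bar>(\<Sum>r<n. Y (x r)) / real n - expectation Y\<bar> \<ge> t} \<subseteq> ?E l \<union> ?E (- l)"
  proof
    fix x assume "x \<in> {x \<in> space ?P. \<bar>(\<Sum>r<n. Y (x r)) / real n - expectation Y\<bar> \<ge> t}"
    then have x: "x \<in> space ?P" and d: "t \<le> \<bar>(\<Sum>r<n. Y (x r)) / real n - expectation Y\<bar>" by auto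
    have s: "(\<Sum>r<n. k * (Y (x r) - expectation Y)) = k * (real n * ((\<Sum>r<n. Y (x r)) / real n - expectation Y))" for k
      using n by (simp add: sum_subtractf right_diff_distrib flip: sum_distrib_left)
    consider "t \<le> (\<Sum>r<n. Y (x r)) / real n - expectation Y" | "t \<le> - ((\<Sum>r<n. Y (x r)) / real n - expectation Y)"
      using d by linarith
    then show "x \<in> ?E l \<union> ?E (- l)"
    proof cases
      case 1
      have "real n * \<bar>l\<bar> * t \<le> l * (real n * ((\<Sum>r<n. Y (x r)) / real n - expectation Y))"
        using mult_left_mono[OF 1, of "real n * l"] l by (simp add: mult_ac)
      then show ?thesis unfolding Un_iff mem_Collect_eq s using x by blast
    next
      case 2
      have "real n * l * t \<le> real n * l * - ((\<Sum>r<n. Y (x r)) / real n - expectation Y)"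
        using 2 l by (intro mult_left_mono) auto
      then have "real n * \<bar>- l\<bar> * t \<le> (- l) * (real n * ((\<Sum>r<n. Y (x r)) / real n - expectation Y))"
        using l by (simp only: abs_minus_cancel abs_of_pos mult_minus_right mult_minus_left mult_ac)
      then show ?thesis unfolding Un_iff mem_Collect_eq s using x by blast
    qed
  qed
  have "measure ?P {x \<in> space ?P. \<bar>(\<Sum>r<n. Y (x r)) / real n - expectation Y\<bar> \<ge> t} \<le> measure ?P (?E l \<union> ?E (- l))"
    by (rule finite_measure.finite_measure_mono[OF fin sub]) measurable
  also have "\<dots> \<le> measure ?P (?E l) + measure ?P (?E (- l))"
    by (rule measure_Un_le) measurable
  also have "\<dots> \<le> 2 * exp (- real n * r)" using E[of l] E[of "- l"] l by simp
  finally show ?thesis unfolding r_def .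
qed

subsection \<open>Quadratic forms on sparse vectors\<close>

text \<open>Scaled by 1 / (4 sqrt s), these points form the net. Sparsity is replaced by an l1
  constraint, which s-sparse unit vectors satisfy with radius sqrt s and which can be counted by
  induction on the radius. Entries beyond \<open>p\<close> are set to 0 to make the set
  finite.\<close>

definition int_ball :: "nat \<Rightarrow> nat \<Rightarrow> (nat \<Rightarrow> int) set" where
  "int_ball p N = {i. (\<forall>k\<ge>p. i k = 0) \<and> (\<Sum>k<p. \<bar>i k\<bar>) \<le> int N}"

lemma int_ball_0: "int_ball p 0 = {\<lambda>_. 0}"
proof -
  have "i = (\<lambda>_. 0)" if "\<forall>k\<ge>p. i k = 0" "(\<Sum>k<p. \<bar>i k\<bar>) \<le> 0" for i :: "nat \<Rightarrow> int"
  proof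
    fix k
    have "(\<Sum>k<p. \<bar>i k\<bar>) = 0" by (rule antisym[OF that(2) sum_nonneg]) simp
    then show "i k = 0" using that(1) by (cases "k < p") (auto simp: sum_nonneg_eq_0_iff)
  qed
  then show ?thesis by (auto simp: int_ball_def)
qed

text \<open>Moving one nonzero coordinate a unit towards 0 lowers the l1 norm by one, so each point
  of the larger ball is a point of the smaller one changed in one coordinate. The change 0 covers
  the case without a nonzero coordinate. Each unit of radius thus costs a factor 3p.\<close>

lemma int_ball_Suc_subset:
  assumes "p > 0"
  shows "int_ball p (Suc N) \<subseteq> (\<lambda>(k, c, i). i(k := i k + c)) ` ({..<p} \<times> {-1, 0, 1} \<times> int_ball p N)"
proof
  fix i assume i: "i \<in> int_ball p (Suc N)"
  show "i \<in> (\<lambda>(k, c, i). i(k := i k + c)) ` ({..<p} \<times> {-1, 0, 1} \<times> int_ball p N)"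
  proof (cases "\<exists>k<p. i k \<noteq> 0")
    case False
    then have "i \<in> int_ball p N" using i by (auto simp: int_ball_def)
    then show ?thesis using assms by (intro image_eqI[of _ _ "(0, 0, i)"]) auto
  next
    case True
    then obtain k where k: "k < p" "i k \<noteq> 0" by blast
    let ?j = "i(k := i k - sgn (i k))"
    have "(\<Sum>l<p. \<bar>?j l\<bar>) = \<bar>?j k\<bar> + (\<Sum>l\<in>{..<p} - {k}. \<bar>?j l\<bar>)"
      using k by (subst sum.remove[of _ k]) auto
    also have "(\<Sum>l\<in>{..<p} - {k}. \<bar>?j l\<bar>) = (\<Sum>l\<in>{..<p} - {k}. \<bar>i l\<bar>)"
      by (intro sum.cong) auto
    also have "\<bar>?j k\<bar> = \<bar>i k\<bar> - 1" using k by (auto simp: sgn_if)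
    also have "\<bar>i k\<bar> - 1 + (\<Sum>l\<in>{..<p} - {k}. \<bar>i l\<bar>) = (\<Sum>l<p. \<bar>i l\<bar>) - 1"
      using k by (subst sum.remove[of "{..<p}" k]) auto
    finally have "?j \<in> int_ball p N" using i k by (auto simp: int_ball_def)
    then show ?thesis using k
      by (intro image_eqI[of _ _ "(k, sgn (i k), ?j)"]) (auto simp: sgn_if)
  qed
qed

lemma int_ball_finite_card:
  assumes "p > 0"
  shows "finite (int_ball p N) \<and> card (int_ball p N) \<le> (3 * p) ^ N"
proof (induction N)
  case 0
  then show ?case by (simp add: int_ball_0)
next
  case (Suc N)
  let ?A = "{..<p} \<times> {-1, 0, 1::int} \<times> int_ball p N"
  have fin: "finite ?A" using Suc by simp
  have "card (int_ball p (Suc N)) \<le> card ((\<lambda>(k, c, i). i(k := i k + c)) ` ?A)"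
    by (intro card_mono finite_imageI fin int_ball_Suc_subset assms)
  also have "\<dots> \<le> card ?A" by (rule card_image_le[OF fin])
  also have "\<dots> = 3 * p * card (int_ball p N)" by (simp add: card_cartesian_product)
  also have "\<dots> \<le> (3 * p) ^ Suc N" using Suc by simp
  finally show ?case
    using finite_subset[OF int_ball_Suc_subset[OF assms] finite_imageI[OF fin]] by simp
qed

section \<open>Bilinear forms, polarization and the net argument\<close>

definition bil :: "nat \<Rightarrow> (nat \<Rightarrow> nat \<Rightarrow> real) \<Rightarrow> (nat \<Rightarrow> real) \<Rightarrow> (nat \<Rightarrow> real) \<Rightarrow> real" where
  "bil p A u w = (\<Sum>k<p. \<Sum>l<p. u k * A k l * w l)"

abbreviation norm1 :: "nat \<Rightarrow> (nat \<Rightarrow> real) \<Rightarrow> real" where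
  "norm1 p u \<equiv> \<Sum>k<p. \<bar>u k\<bar>"

abbreviation norm2 :: "nat \<Rightarrow> (nat \<Rightarrow> real) \<Rightarrow> real" where
  "norm2 p u \<equiv> L2_set u {..<p}"

lemma bil_add_left: "bil p A (\<lambda>k. u k + v k) w = bil p A u w + bil p A v w"
  and bil_add_right: "bil p A w (\<lambda>k. u k + v k) = bil p A w u + bil p A w v"
  and bil_diff_left: "bil p A (\<lambda>k. u k - v k) w = bil p A u w - bil p A v w"
  and bil_diff_right: "bil p A w (\<lambda>k. u k - v k) = bil p A w u - bil p A w v"
  and bil_scale_left: "bil p A (\<lambda>k. c * u k) w = c * bil p A u w"
  and bil_scale_right: "bil p A w (\<lambda>k. c * u k) = c * bil p A w u"
  and bil_diff_matrix: "bil p (\<lambda>k l. A k l - B k l) u w = bil p A u w - bil p B u w"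
  by (simp_all add: bil_def algebra_simps sum.distrib sum_subtractf sum_distrib_left)

lemmas bil_simps = bil_add_left bil_add_right bil_diff_left bil_diff_right bil_scale_left bil_scale_right

lemma bil_sym:
  assumes "\<And>a b. a < p \<Longrightarrow> b < p \<Longrightarrow> A a b = A b a"
  shows "bil p A u w = bil p A w u"
  unfolding bil_def by (subst sum.swap) (intro sum.cong refl, simp add: assms mult_ac)

lemma bil_matrix_vector: "bil p A u w = (\<Sum>k<p. u k * (\<Sum>l<p. A k l * w l))"
  by (simp add: bil_def sum_distrib_left mult_ac)

lemma abs_bil_le_norm1:
  assumes "\<And>k. k < p \<Longrightarrow> \<bar>\<Sum>l<p. A k l * w l\<bar> \<le> c"
  shows "\<bar>bil p A u w\<bar> \<le> norm1 p u * c"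
proof -
  have "\<bar>bil p A u w\<bar> \<le> (\<Sum>k<p. \<bar>u k\<bar> * \<bar>\<Sum>l<p. A k l * w l\<bar>)"
    unfolding bil_matrix_vector by (rule order_trans[OF sum_abs]) (simp add: abs_mult)
  also have "\<dots> \<le> (\<Sum>k<p. \<bar>u k\<bar> * c)"
    using assms by (intro sum_mono mult_left_mono) auto
  finally show ?thesis by (simp add: sum_distrib_right)
qed

lemma norm2_sq: "(norm2 p u)\<^sup>2 = (\<Sum>k<p. (u k)\<^sup>2)"
  by (simp add: L2_set_def sum_nonneg)

lemma norm2_scale: "norm2 p (\<lambda>k. c * u k) = \<bar>c\<bar> * norm2 p u"
  by (simp add: L2_set_def power_mult_distrib real_sqrt_mult flip: sum_distrib_left)

lemma parallelogram:
  "(norm2 p (\<lambda>k. u k + v k))\<^sup>2 + (norm2 p (\<lambda>k. u k - v k))\<^sup>2 = 2 * (norm2 p u)\<^sup>2 + 2 * (norm2 p v)\<^sup>2"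
  by (simp add: norm2_sq power2_sum power2_diff sum_distrib_left flip: sum.distrib)

abbreviation supp :: "nat \<Rightarrow> (nat \<Rightarrow> real) \<Rightarrow> nat set" where
  "supp p u \<equiv> {k. k < p \<and> u k \<noteq> 0}"

lemma norm1_sparse_le:
  assumes "finite S" "card S \<le> s"
  shows "(\<Sum>k\<in>S. \<bar>u k :: real\<bar>) \<le> sqrt s * L2_set u S"
proof -
  have "(\<Sum>k\<in>S. \<bar>u k\<bar>) = (\<Sum>k\<in>S. \<bar>1\<bar> * \<bar>u k\<bar>)" by simp
  also have "\<dots> \<le> L2_set (\<lambda>_. 1) S * L2_set u S" by (rule L2_set_mult_ineq)
  also have "\<dots> \<le> sqrt s * L2_set u S"
    using assms by (intro mult_right_mono) (auto simp: L2_set_def sum_nonneg)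
  finally show ?thesis .
qed

lemma L2_set_le_norm2: "S \<subseteq> {..<p} \<Longrightarrow> L2_set u S \<le> norm2 p u"
  unfolding L2_set_def by (intro real_sqrt_le_mono sum_mono2) auto

lemma norm1_supp_le:
  assumes "card (supp p u) \<le> s"
  shows "norm1 p u \<le> sqrt s * norm2 p u"
proof -
  have "norm1 p u = (\<Sum>k\<in>supp p u. \<bar>u k\<bar>)" by (rule sum.mono_neutral_right) auto
  also have "\<dots> \<le> sqrt s * L2_set u (supp p u)" by (rule norm1_sparse_le) (use assms in auto)
  also have "\<dots> \<le> sqrt s * norm2 p u" by (intro mult_left_mono L2_set_le_norm2) auto
  finally show ?thesis .
qed

text \<open>Polarization and the parallelogram law give Z/2 times the sum of the squared norms;
  normalising both vectors turns this sum into the product. A common set \<open>S\<close> is fixed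
  because sums and differences of vectors supported in \<open>S\<close> stay supported in
  \<open>S\<close>, which a bound on the number of nonzero entries would not guarantee.\<close>

lemma bil_sparse_polarize:
  fixes D
  assumes sym: "\<And>a b. a < p \<Longrightarrow> b < p \<Longrightarrow> D a b = D b a"
    and Z: "\<And>w. supp p w \<subseteq> S \<Longrightarrow> \<bar>bil p D w w\<bar> \<le> Z * (norm2 p w)\<^sup>2"
    and u: "supp p u \<subseteq> S" and v: "supp p v \<subseteq> S"
  shows "\<bar>bil p D u v\<bar> \<le> Z * norm2 p u * norm2 p v"
proof -
  have half: "\<bar>bil p D a b\<bar> \<le> Z / 2 * ((norm2 p a)\<^sup>2 + (norm2 p b)\<^sup>2)"
    if "supp p a \<subseteq> S" "supp p b \<subseteq> S" for a b
  proof -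
    have "4 * bil p D a b = bil p D (\<lambda>k. a k + b k) (\<lambda>k. a k + b k) - bil p D (\<lambda>k. a k - b k) (\<lambda>k. a k - b k)"
      using bil_sym[of p D a b, OF sym] by (simp add: bil_simps)
    moreover have "\<bar>bil p D (\<lambda>k. a k + b k) (\<lambda>k. a k + b k)\<bar> \<le> Z * (norm2 p (\<lambda>k. a k + b k))\<^sup>2"
      using that by (intro Z) fastforce
    moreover have "\<bar>bil p D (\<lambda>k. a k - b k) (\<lambda>k. a k - b k)\<bar> \<le> Z * (norm2 p (\<lambda>k. a k - b k))\<^sup>2"
      using that by (intro Z) fastforce
    moreover have "Z * (norm2 p (\<lambda>k. a k + b k))\<^sup>2 + Z * (norm2 p (\<lambda>k. a k - b k))\<^sup>2
        = 2 * Z * ((norm2 p a)\<^sup>2 + (norm2 p b)\<^sup>2)"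
      using arg_cong[OF parallelogram[of a b p], of "\<lambda>t. Z * t"] by (simp add: algebra_simps)
    ultimately show ?thesis by (simp add: field_simps)
  qed
  have zero: "norm2 p a = 0 \<Longrightarrow> bil p D a b = 0 \<and> bil p D b a = 0" for a b
    by (auto simp: bil_def L2_set_eq_0_iff)
  show ?thesis
  proof (cases "norm2 p u = 0 \<or> norm2 p v = 0")
    case True
    then show ?thesis using zero[of u v] zero[of v u] by auto
  next
    case False
    let ?u = "\<lambda>k. (1 / norm2 p u) * u k" and ?v = "\<lambda>k. (1 / norm2 p v) * v k"
    have pos: "norm2 p u > 0" "norm2 p v > 0" using False L2_set_nonneg order_less_le by metis+
    have "\<bar>bil p D ?u ?v\<bar> \<le> Z / 2 * ((norm2 p ?u)\<^sup>2 + (norm2 p ?v)\<^sup>2)"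
      by (rule half) (use u v in auto)
    moreover have "norm2 p ?u = 1" "norm2 p ?v = 1" using pos by (simp_all only: norm2_scale) simp_all
    moreover have "bil p D ?u ?v = bil p D u v / (norm2 p u * norm2 p v)"
      by (simp only: bil_scale_left bil_scale_right) simp
    ultimately have "\<bar>bil p D u v / (norm2 p u * norm2 p v)\<bar> \<le> Z" by (simp only: power_one) simp
    then show ?thesis using pos by (simp add: abs_mult pos_divide_le_eq mult.assoc)
  qed
qed

text \<open>Let \<open>Z\<close> be the supremum of the form over s-sparse vectors in the unit ball.
  Rounding such a v to a net point z changes the form by D(v - z, v + z), where v - z has norm at
  most 1/4 and v + z norm at most 2, so the change is at most Z/2. Hence Z \<le> e/2 + Z/2, and
  since \<open>Z\<close> is finite it can be absorbed on the left.\<close>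

lemma sparse_net_bound:
  fixes D :: "nat \<Rightarrow> nat \<Rightarrow> real"
  assumes sym: "\<And>a b. a < p \<Longrightarrow> b < p \<Longrightarrow> D a b = D b a"
    and s: "s \<ge> 1"
    and net: "\<And>i. i \<in> int_ball p (4 * s) \<Longrightarrow> norm2 p (\<lambda>k. 1 / (4 * sqrt s) * i k) \<le> 1 \<Longrightarrow>
        \<bar>bil p D (\<lambda>k. 1 / (4 * sqrt s) * i k) (\<lambda>k. 1 / (4 * sqrt s) * i k)\<bar> \<le> e / 2"
    and w: "card (supp p w) \<le> s"
  shows "\<bar>bil p D w w\<bar> \<le> e * (norm2 p w)\<^sup>2"
proof -
  define V where "V = {v. card (supp p v) \<le> s \<and> norm2 p v \<le> 1}"
  define Q where "Q v = \<bar>bil p D v v\<bar>" for v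
  define Z where "Z = (SUP v\<in>V. Q v)"
  define h where "h = 1 / (4 * sqrt s)"
  have h: "h > 0" and hs: "h * sqrt s = 1 / 4" using s by (auto simp: h_def)
  have bdd: "bdd_above (Q ` V)"
  proof (rule bdd_aboveI2)
    fix v assume "v \<in> V"
    then have v1: "\<bar>v k\<bar> \<le> 1" if "k < p" for k
      using member_le_L2_set[of "{..<p}" k "\<lambda>k. \<bar>v k\<bar>"] that order_trans by (fastforce simp: V_def L2_set_def)
    have "Q v \<le> (\<Sum>k<p. \<Sum>l<p. \<bar>v k * D k l * v l\<bar>)"
      unfolding Q_def bil_def by (intro order_trans[OF sum_abs] sum_mono order_refl)
    also have "\<dots> \<le> (\<Sum>k<p. \<Sum>l<p. 1 * \<bar>D k l\<bar> * 1)"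
      unfolding abs_mult using v1 by (intro sum_mono mult_mono) auto
    finally show "Q v \<le> (\<Sum>k<p. \<Sum>l<p. \<bar>D k l\<bar>)" by simp
  qed
  have Q0: "(\<lambda>_. 0) \<in> V" by (simp add: V_def L2_set_def)
  have QZ: "Q v \<le> Z" if "v \<in> V" for v
    unfolding Z_def by (rule cSUP_upper[OF that bdd])
  have hom: "Q v \<le> Z * (norm2 p v)\<^sup>2" if v: "card (supp p v) \<le> s" for v
  proof (cases "norm2 p v = 0")
    case True
    then have "\<And>k. k < p \<Longrightarrow> v k = 0" by (auto simp: L2_set_eq_0_iff)
    then show ?thesis using True by (simp add: Q_def bil_def)
  next
    case False
    let ?v = "\<lambda>k. (1 / norm2 p v) * v k"
    have pos: "norm2 p v > 0" using False L2_set_nonneg order_less_le by metis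
    have "norm2 p ?v = 1" using pos by (simp only: norm2_scale) simp
    then have "?v \<in> V" using v pos by (simp add: V_def)
    moreover have "Q ?v = Q v / (norm2 p v)\<^sup>2"
      unfolding Q_def bil_scale_left bil_scale_right by (simp add: abs_mult power2_eq_square)
    ultimately have "Q v / (norm2 p v)\<^sup>2 \<le> Z" using QZ by metis
    then show ?thesis using pos by (simp add: field_simps)
  qed
  have step: "Q v \<le> e / 2 + Z / 2" if v: "v \<in> V" for v
  proof -
    \<comment> \<open>Rounding goes towards zero rather than to the nearest grid point, so neither
      the support nor any absolute value grows and z stays in the sparse unit ball. The mesh
      \<open>h\<close> is chosen such that an error of at most \<open>h\<close> in s coordinates has
      norm at most h sqrt s = 1/4.\<close>
    define i where "i k = (if k < p then \<lfloor>\<bar>v k\<bar> / h\<rfloor> * (if v k \<ge> 0 then 1 else -1) else 0)" for k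
    define z where "z k = h * i k" for k
    have i_abs: "\<bar>i k\<bar> = \<lfloor>\<bar>v k\<bar> / h\<rfloor>" if "k < p" for k
      using that h by (auto simp: i_def abs_mult)
    have fl: "h * real_of_int \<lfloor>\<bar>v k\<bar> / h\<rfloor> \<le> \<bar>v k\<bar>" "\<bar>v k\<bar> - h \<le> h * real_of_int \<lfloor>\<bar>v k\<bar> / h\<rfloor>" for k
    proof -
      have "h * real_of_int \<lfloor>\<bar>v k\<bar> / h\<rfloor> \<le> h * (\<bar>v k\<bar> / h)"
        using h by (intro mult_left_mono of_int_floor_le) auto
      also have "\<dots> = \<bar>v k\<bar>" using h by simp
      finally show "h * real_of_int \<lfloor>\<bar>v k\<bar> / h\<rfloor> \<le> \<bar>v k\<bar>" .
      have "\<bar>v k\<bar> / h - 1 \<le> real_of_int \<lfloor>\<bar>v k\<bar> / h\<rfloor>" by linarith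
      then show "\<bar>v k\<bar> - h \<le> h * real_of_int \<lfloor>\<bar>v k\<bar> / h\<rfloor>" using h by (simp add: field_simps)
    qed
    have z_abs: "\<bar>z k\<bar> \<le> \<bar>v k\<bar>" and z_diff: "\<bar>v k - z k\<bar> \<le> h" if "k < p" for k
      using fl[of k] h that by (auto simp: z_def i_def abs_mult)
    have zS: "supp p z \<subseteq> supp p v" using z_abs by fastforce
    have z2: "norm2 p z \<le> norm2 p v"
      unfolding L2_set_def using z_abs by (intro real_sqrt_le_mono sum_mono) (auto intro: abs_le_square_iff[THEN iffD1])
    have v_card: "card (supp p v) \<le> s" and v_norm: "norm2 p v \<le> 1" using v by (auto simp: V_def)
    have "h * real_of_int (\<Sum>k<p. \<bar>i k\<bar>) = (\<Sum>k<p. \<bar>z k\<bar>)"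
      using h by (simp add: z_def abs_mult sum_distrib_left)
    also have "\<dots> \<le> norm1 p v" by (intro sum_mono z_abs) simp
    also have "\<dots> \<le> sqrt s * 1"
      by (intro order_trans[OF norm1_supp_le[OF v_card]] mult_left_mono v_norm) auto
    \<comment> \<open>This is the origin of the radius 4s: the l1 bound sqrt s, measured in units of
      the mesh.\<close>
    also have "\<dots> = h * (4 * s)"
      using s by (simp add: h_def field_simps)
    finally have "real_of_int (\<Sum>k<p. \<bar>i k\<bar>) \<le> 4 * s" using h by simp
    then have "(\<Sum>k<p. \<bar>i k\<bar>) \<le> int (4 * s)" by linarith
    then have iN: "i \<in> int_ball p (4 * s)" by (auto simp: int_ball_def i_def)
    have z_eq: "z = (\<lambda>k. 1 / (4 * sqrt s) * i k)" by (simp add: z_def h_def fun_eq_iff)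
    have Qz: "Q z \<le> e / 2"
      using net[OF iN, folded z_eq] z2 v_norm unfolding Q_def by linarith
    let ?d = "\<lambda>k. v k - z k" and ?a = "\<lambda>k. v k + z k"
    have d_supp: "supp p ?d \<subseteq> supp p v" and a_supp: "supp p ?a \<subseteq> supp p v"
      using zS by fastforce+
    have "L2_set ?d (supp p v) \<le> L2_set (\<lambda>_. h) (supp p v)"
      unfolding L2_set_def using z_diff h
      by (intro real_sqrt_le_mono sum_mono) (auto intro!: abs_le_square_iff[THEN iffD1])
    also have "\<dots> = h * sqrt (card (supp p v))"
      using h by (simp add: L2_set_def real_sqrt_mult)
    also have "\<dots> \<le> h * sqrt s" using v_card h by (intro mult_left_mono) auto
    also have "L2_set ?d (supp p v) = norm2 p ?d"
      unfolding L2_set_def using d_supp by (intro arg_cong[of _ _ sqrt] sum.mono_neutral_left) auto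
    finally have d2: "norm2 p ?d \<le> 1 / 4" using hs by simp
    have a2: "norm2 p ?a \<le> 2"
      using L2_set_triangle_ineq[of v z "{..<p}"] z2 v_norm by linarith
    have Z0: "Z \<ge> 0" using QZ[OF Q0] by (simp add: Q_def bil_def)
    have "\<bar>bil p D ?d ?a\<bar> \<le> Z * norm2 p ?d * norm2 p ?a"
    proof (rule bil_sparse_polarize[where S = "supp p v", OF sym])
      fix w assume w: "supp p w \<subseteq> supp p v"
      have "card (supp p w) \<le> card (supp p v)" by (rule card_mono[OF _ w]) simp
      then show "\<bar>bil p D w w\<bar> \<le> Z * (norm2 p w)\<^sup>2"
        using hom[of w] v_card by (simp add: Q_def)
    qed (use d_supp a_supp in auto)
    also have "\<dots> \<le> Z * (1 / 4) * 2"
      using d2 a2 Z0 by (intro mult_mono) auto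
    finally have "\<bar>bil p D ?d ?a\<bar> \<le> Z / 2" by simp
    moreover have "bil p D v v = bil p D z z + bil p D ?d ?a"
      using bil_sym[of p D v z, OF sym] by (simp add: bil_simps)
    ultimately show ?thesis using Qz by (simp add: Q_def)
  qed
  have "Z \<le> e / 2 + Z / 2"
    unfolding Z_def by (rule cSUP_least) (use Q0 step in \<open>auto simp: Z_def\<close>)
  then have "Z \<le> e" by simp
  then show ?thesis
    using hom[OF w] mult_right_mono[of Z e "(norm2 p w)\<^sup>2"] by (simp add: Q_def)
qed

section \<open>Shelling: from sparse vectors to arbitrary vectors\<close>

lemma ex_top_subset:
  fixes g :: "'a \<Rightarrow> real"
  assumes "finite A" "s \<le> card A"
  shows "\<exists>T\<subseteq>A. card T = s \<and> (\<forall>k\<in>T. \<forall>l\<in>A - T. g l \<le> g k)"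
  using assms(2)
proof (induction s)
  case 0
  then show ?case by (intro exI[of _ "{}"]) auto
next
  case (Suc s)
  then obtain T where T: "T \<subseteq> A" "card T = s" "\<forall>k\<in>T. \<forall>l\<in>A - T. g l \<le> g k" by auto
  have fT: "finite T" using T assms finite_subset by blast
  have ne: "A - T \<noteq> {}" using T Suc.prems by auto
  have "Max (g ` (A - T)) \<in> g ` (A - T)" using ne assms by (intro Max_in) auto
  then obtain m where m: "m \<in> A - T" "g m = Max (g ` (A - T))" by auto
  have "\<forall>l\<in>A - T. g l \<le> g m" using m assms by auto
  then show ?case using T m fT by (intro exI[of _ "insert m T"]) auto
qed

lemma norm2_mono: "(\<And>k. k < p \<Longrightarrow> \<bar>u k\<bar> \<le> \<bar>v k\<bar>) \<Longrightarrow> norm2 p u \<le> norm2 p v"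
  unfolding L2_set_def by (intro real_sqrt_le_mono sum_mono) (simp add: abs_le_square_iff[symmetric])

lemma norm2_sparse_le:
  assumes "\<And>k. k < p \<Longrightarrow> \<bar>u k\<bar> \<le> M" "M \<ge> 0" "card (supp p u) \<le> s"
  shows "norm2 p u \<le> M * sqrt s"
proof -
  have "norm2 p u = L2_set u (supp p u)"
    unfolding L2_set_def by (intro arg_cong[of _ _ sqrt] sum.mono_neutral_right) auto
  also have "\<dots> \<le> L2_set (\<lambda>_. M) (supp p u)"
    unfolding L2_set_def using assms
    by (intro real_sqrt_le_mono sum_mono) (auto intro!: abs_le_square_iff[THEN iffD1])
  also have "\<dots> = M * sqrt (card (supp p u))" using assms by (simp add: L2_set_def real_sqrt_mult)
  also have "\<dots> \<le> M * sqrt s" using assms by (intro mult_left_mono) auto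
  finally show ?thesis .
qed

text \<open>Here \<open>a\<close> collects the \<open>s\<close> largest coordinates of \<open>v\<close>, and \<open>m\<close> is their average size.\<close>

lemma shelling_split:
  assumes s: "s \<ge> 1" and big: "\<not> card (supp p v) \<le> s"
  obtains a b m where "v = (\<lambda>k. a k + b k)" "\<forall>k. \<bar>a k\<bar> \<le> \<bar>v k\<bar>" "card (supp p a) \<le> s"
    "card (supp p b) < card (supp p v)" "\<forall>k<p. \<bar>b k\<bar> \<le> m" "m \<ge> 0"
    "m * sqrt s + norm1 p b / sqrt s = norm1 p v / sqrt s"
proof -
  obtain T where T: "T \<subseteq> supp p v" "card T = s" "\<forall>k\<in>T. \<forall>l\<in>supp p v - T. \<bar>v l\<bar> \<le> \<bar>v k\<bar>"
    using ex_top_subset[of "supp p v" s "\<lambda>k. \<bar>v k\<bar>"] big by auto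
  have Tp: "T \<subseteq> {..<p}" using T(1) by auto
  have T0: "T \<noteq> {}" using T(2) s by auto
  define a where "a k = (if k \<in> T then v k else 0)" for k
  define b where "b k = (if k \<in> T then 0 else v k)" for k
  define m where "m = (\<Sum>k\<in>T. \<bar>v k\<bar>) / s"
  have m0: "m \<ge> 0" by (simp add: m_def sum_nonneg)
  have bm: "\<bar>b k\<bar> \<le> m" if "k < p" for k
  proof (cases "k \<in> T \<or> v k = 0")
    case True
    then show ?thesis using m0 by (auto simp: b_def)
  next
    case False
    then have "\<And>l. l \<in> T \<Longrightarrow> \<bar>v k\<bar> \<le> \<bar>v l\<bar>" using T(3) that by auto
    then have "s * \<bar>v k\<bar> \<le> (\<Sum>l\<in>T. \<bar>v l\<bar>)"
      using sum_mono[of T "\<lambda>_. \<bar>v k\<bar>" "\<lambda>l. \<bar>v l\<bar>"] T(2) by simp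
    then show ?thesis using s False by (simp add: m_def b_def field_simps)
  qed
  have asupp: "supp p a = T" using T(1) by (auto simp: a_def)
  have bsupp: "supp p b = supp p v - T" by (auto simp: b_def)
  have card_b: "card (supp p b) < card (supp p v)"
    unfolding bsupp using T(1) T0 by (intro psubset_card_mono) auto
  have "norm1 p v = (\<Sum>k\<in>T. \<bar>v k\<bar>) + norm1 p b"
  proof -
    have "norm1 p v = (\<Sum>k\<in>T. \<bar>v k\<bar>) + (\<Sum>k\<in>{..<p} - T. \<bar>v k\<bar>)"
      using Tp by (simp add: sum.subset_diff[of T "{..<p}"])
    also have "(\<Sum>k\<in>{..<p} - T. \<bar>v k\<bar>) = norm1 p b"
      by (intro sum.mono_neutral_cong_left) (auto simp: b_def)
    finally show ?thesis .
  qed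
  moreover have "m * sqrt s = (\<Sum>k\<in>T. \<bar>v k\<bar>) / sqrt s"
    using s by (simp add: m_def field_simps)
  ultimately have "m * sqrt s + norm1 p b / sqrt s = norm1 p v / sqrt s"
    by (simp add: add_divide_distrib)
  moreover have "v = (\<lambda>k. a k + b k)" "\<forall>k. \<bar>a k\<bar> \<le> \<bar>v k\<bar>" by (auto simp: a_def b_def)
  moreover have "card (supp p a) \<le> s" using asupp T(2) by simp
  ultimately show ?thesis by (intro that[of a b m] allI impI bm m0 card_b) auto
qed

text \<open>Shelling: cut the coordinates into blocks of size \<open>s\<close> in decreasing order of magnitude. The
  Euclidean norm of each block is at most \<open>1 / sqrt s\<close> times the l1 norm of the preceding one.\<close>

lemma shelling_tail:
  fixes f :: "(nat \<Rightarrow> real) \<Rightarrow> real"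
  assumes s: "s \<ge> 1" and c: "c \<ge> 0"
    and add: "\<And>u v. f (\<lambda>k. u k + v k) \<le> f u + f v"
    and sparse: "\<And>w. card (supp p w) \<le> s \<Longrightarrow> f w \<le> c * norm2 p w"
    and M: "\<And>k. k < p \<Longrightarrow> \<bar>v k\<bar> \<le> M" "M \<ge> 0"
  shows "f v \<le> c * (M * sqrt s + norm1 p v / sqrt s)"
  using M
proof (induction "card (supp p v)" arbitrary: v M rule: less_induct)
  case less
  show ?case
  proof (cases "card (supp p v) \<le> s")
    case True
    have "norm2 p v \<le> M * sqrt s + norm1 p v / sqrt s"
      using norm2_sparse_le[OF less.prems True] by (simp add: sum_nonneg add_increasing2)
    then show ?thesis using sparse[OF True] c mult_left_mono order_trans by blast
  next
    case False
    obtain a b m where ab: "v = (\<lambda>k. a k + b k)" "\<forall>k. \<bar>a k\<bar> \<le> \<bar>v k\<bar>" "card (supp p a) \<le> s"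
      "card (supp p b) < card (supp p v)" "\<forall>k<p. \<bar>b k\<bar> \<le> m" "m \<ge> 0"
      "m * sqrt s + norm1 p b / sqrt s = norm1 p v / sqrt s"
      by (rule shelling_split[OF s False]) (rule that; assumption)
    have "norm2 p a \<le> M * sqrt s"
      by (rule norm2_sparse_le[OF _ less.prems(2) ab(3)]) (rule order_trans[OF ab(2)[rule_format] less.prems(1)])
    then have "f a \<le> c * (M * sqrt s)" using sparse[OF ab(3)] c mult_left_mono order_trans by blast
    \<comment> \<open>The induction hypothesis is used with \<open>m\<close> in place of
      \<open>M\<close>; the contribution m sqrt s is exactly the l1 mass of the removed block over
      sqrt s, so the block bounds telescope.\<close>
    moreover have "f b \<le> c * (norm1 p v / sqrt s)"
      using less.hyps[OF ab(4) ab(5)[rule_format] ab(6)] ab(7) by simp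
    ultimately show ?thesis using add[of a b] ab(1) by (simp add: distrib_left)
  qed
qed

text \<open>The leading block has no predecessor to be charged to, so it is bounded by the Euclidean
  norm of \<open>v\<close>; all further blocks are covered by \<open>shelling_tail\<close> with the
  average size of the leading block as sup bound. Subadditivity is all that is required of
  \<open>f\<close>, which allows the absolute value of a form with one argument fixed.\<close>

lemma shelling:
  fixes f :: "(nat \<Rightarrow> real) \<Rightarrow> real"
  assumes s: "s \<ge> 1" and c: "c \<ge> 0"
    and add: "\<And>u v. f (\<lambda>k. u k + v k) \<le> f u + f v"
    and sparse: "\<And>w. card (supp p w) \<le> s \<Longrightarrow> f w \<le> c * norm2 p w"
  shows "f v \<le> c * (norm2 p v + norm1 p v / sqrt s)"
proof (cases "card (supp p v) \<le> s")
  case True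
  have "norm2 p v \<le> norm2 p v + norm1 p v / sqrt s" by (simp add: sum_nonneg)
  then show ?thesis using sparse[OF True] c mult_left_mono order_trans by blast
next
  case False
  obtain a b m where ab: "v = (\<lambda>k. a k + b k)" "\<forall>k. \<bar>a k\<bar> \<le> \<bar>v k\<bar>" "card (supp p a) \<le> s"
    "card (supp p b) < card (supp p v)" "\<forall>k<p. \<bar>b k\<bar> \<le> m" "m \<ge> 0" "m * sqrt s + norm1 p b / sqrt s = norm1 p v / sqrt s"
    by (rule shelling_split[OF s False]) (rule that; assumption)
  have "norm2 p a \<le> norm2 p v" by (rule norm2_mono) (rule ab(2)[rule_format])
  then have "f a \<le> c * norm2 p v" using sparse[OF ab(3)] c mult_left_mono order_trans by blast
  moreover have "f b \<le> c * (m * sqrt s + norm1 p b / sqrt s)"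
    using s c add sparse ab(5)[rule_format] ab(6) by (rule shelling_tail)
  then have "f b \<le> c * (norm1 p v / sqrt s)" unfolding ab(7) .
  ultimately show ?thesis using add[of a b] ab(1) by (simp add: distrib_left)
qed

text \<open>Shelling is applied to one argument at a time, first with the other argument sparse and
  then with it equal to \<open>v\<close>. Sparsity 2s is assumed since polarizing two s-sparse
  vectors involves the union of their supports.\<close>

lemma bil_sparse_to_all:
  fixes D :: "nat \<Rightarrow> nat \<Rightarrow> real"
  assumes sym: "\<And>a b. a < p \<Longrightarrow> b < p \<Longrightarrow> D a b = D b a"
    and s: "s \<ge> 1" and e: "e \<ge> 0"
    and sparse: "\<And>w. card (supp p w) \<le> 2 * s \<Longrightarrow> \<bar>bil p D w w\<bar> \<le> e * (norm2 p w)\<^sup>2"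
  shows "\<bar>bil p D v v\<bar> \<le> e * (norm2 p v + norm1 p v / sqrt s)\<^sup>2"
proof -
  let ?N = "norm2 p v + norm1 p v / sqrt s"
  have N: "?N \<ge> 0" by (simp add: sum_nonneg)
  have sp: "\<bar>bil p D u w\<bar> \<le> e * norm2 p w * norm2 p u" if "card (supp p u) \<le> s" "card (supp p w) \<le> s" for u w
  proof -
    have "\<bar>bil p D u w\<bar> \<le> e * norm2 p u * norm2 p w"
    proof (rule bil_sparse_polarize[where S = "supp p u \<union> supp p w", OF sym])
      fix y assume y: "supp p y \<subseteq> supp p u \<union> supp p w"
      have "card (supp p y) \<le> card (supp p u \<union> supp p w)" by (rule card_mono[OF _ y]) simp
      also have "\<dots> \<le> 2 * s" using card_Un_le[of "supp p u" "supp p w"] that by linarith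
      finally show "\<bar>bil p D y y\<bar> \<le> e * (norm2 p y)\<^sup>2" by (rule sparse)
    qed auto
    then show ?thesis by (simp add: mult_ac)
  qed
  have half: "\<bar>bil p D v w\<bar> \<le> (e * ?N) * norm2 p w" if w: "card (supp p w) \<le> s" for w
  proof -
    have "\<bar>bil p D v w\<bar> \<le> (e * norm2 p w) * ?N"
      by (rule shelling[OF s]) (use e sp w in \<open>auto simp: bil_add_left\<close>)
    then show ?thesis by (simp add: mult_ac)
  qed
  have "\<bar>bil p D v v\<bar> \<le> (e * ?N) * ?N"
    by (rule shelling[OF s]) (use e N half in \<open>auto simp: bil_add_right\<close>)
  then show ?thesis by (simp add: power2_eq_square mult_ac)
qed

subsection \<open>Smallest eigenvalues\<close>

text \<open>Vectors are functions on all naturals, so compactness comes from the product topology: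
  coordinates below \<open>p\<close> range over an interval and the others are set to 0. An
  arbitrary competitor \<open>w\<close> is truncated to this set, which affects neither its norm nor
  the form.\<close>

lemma sphere_attains_inf:
  assumes "p \<ge> 1"
  obtains v where "norm2 p v = 1" "\<And>w. norm2 p w = 1 \<Longrightarrow> bil p A v v \<le> bil p A w w"
proof -
  define C where "C = PiE UNIV (\<lambda>k. if k < p then {-1..1} else {0::real})"
  define S where "S = C \<inter> {v. norm2 p v = 1}"
  have "compactin (product_topology (\<lambda>_::nat. euclidean) UNIV) C"
    unfolding C_def by (subst compactin_PiE) auto
  then have "compact C" by (simp add: euclidean_product_topology flip: compactin_euclidean_iff)
  moreover have "closed {v. norm2 p v = 1}"
    unfolding L2_set_def by (intro closed_Collect_eq continuous_intros continuous_on_product_coordinates)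
  ultimately have "compact S" unfolding S_def by (rule compact_Int_closed)
  moreover have "(\<lambda>k. if k = 0 then 1 else 0) \<in> S"
    using assms by (auto simp: S_def C_def L2_set_def if_distrib[of "\<lambda>x. x\<^sup>2"] sum.delta cong: if_cong)
  then have "S \<noteq> {}" by blast
  moreover have "continuous_on S (\<lambda>v. bil p A v v)"
    unfolding bil_def
    by (intro continuous_intros continuous_on_product_coordinates[THEN continuous_on_subset]) auto
  ultimately obtain v where v: "v \<in> S" "\<forall>w\<in>S. bil p A v v \<le> bil p A w w"
    using continuous_attains_inf by blast
  show ?thesis
  proof (rule that)
    show "norm2 p v = 1" using v(1) by (simp add: S_def)
    fix w assume w: "norm2 p w = 1"
    let ?w = "\<lambda>k. if k < p then w k else 0"
    have "\<bar>w k\<bar> \<le> 1" if "k < p" for k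
      using member_le_L2_set[of "{..<p}" k "\<lambda>k. \<bar>w k\<bar>"] that w by (simp add: L2_set_def)
    then have "?w \<in> C" by (auto simp: C_def abs_le_iff)
    moreover have "norm2 p ?w = norm2 p w" by (auto simp: L2_set_def)
    ultimately have "?w \<in> S" using w by (simp add: S_def)
    moreover have "bil p A ?w ?w = bil p A w w" by (auto simp: bil_def)
    ultimately show "bil p A v v \<le> bil p A w w" using v(2) by metis
  qed
qed

lemma linear_coeff_zero:
  fixes a b :: real
  assumes "\<And>t. 0 \<le> a * t + b * t\<^sup>2"
  shows "a = 0"
proof (rule ccontr)
  assume a: "a \<noteq> 0"
  \<comment> \<open>With c > b, the quadratic part at t = - a / c is too small to compensate the
    linear part - a^2 / c.\<close>
  define c where "c = \<bar>b\<bar> + 1"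
  have c: "c > 0" "b < c" by (auto simp: c_def)
  have "0 \<le> a * (- a / c) + b * (- a / c)\<^sup>2" by (rule assms)
  also have "\<dots> = a\<^sup>2 * (b - c) / c\<^sup>2"
    using c by (simp add: field_simps power2_eq_square)
  also have "\<dots> < 0" using a c by (simp add: divide_neg_pos mult_pos_neg)
  finally show False by simp
qed

text \<open>First variation: perturbing a minimiser v on the sphere by t times the i-th unit vector
  gives a nonnegative polynomial in t without constant term, and its linear coefficient is twice the
  i-th component of A v - m v.\<close>

lemma ex_min_eigenvector:
  assumes p: "p \<ge> 1" and sym: "\<And>a b. a < p \<Longrightarrow> b < p \<Longrightarrow> A a b = A b a"
  obtains v m where "norm2 p v = 1" "\<And>i. i < p \<Longrightarrow> (\<Sum>k<p. A i k * v k) = m * v i"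
    "\<And>w. m * (norm2 p w)\<^sup>2 \<le> bil p A w w"
proof -
  obtain v where v: "norm2 p v = 1" "\<And>w. norm2 p w = 1 \<Longrightarrow> bil p A v v \<le> bil p A w w"
    using sphere_attains_inf[OF p, of A] by blast
  define m where "m = bil p A v v"
  have min: "m * (norm2 p w)\<^sup>2 \<le> bil p A w w" for w
  proof (cases "norm2 p w = 0")
    case True
    then have "bil p A w w = 0" by (auto simp: bil_def L2_set_eq_0_iff)
    then show ?thesis using True by simp
  next
    case False
    then have pos: "norm2 p w > 0" using L2_set_nonneg order_less_le by metis
    have "norm2 p (\<lambda>k. (1 / norm2 p w) * w k) = 1" using pos by (simp only: norm2_scale) simp
    from v(2)[OF this] have "m \<le> bil p A w w / (norm2 p w)\<^sup>2"
      unfolding m_def bil_scale_left bil_scale_right by (simp add: power2_eq_square)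
    then show ?thesis using pos by (simp add: field_simps)
  qed
  have "(\<Sum>k<p. A i k * v k) = m * v i" if i: "i < p" for i
  proof -
    define e where "e k = (if k = i then 1 else 0 :: real)" for k
    have e: "(\<Sum>k<p. e k * x k) = x i" for x
      using i by (simp add: e_def if_distrib[of "\<lambda>y. y * _"] cong: if_cong)
    have "0 \<le> (2 * ((\<Sum>k<p. A i k * v k) - m * v i)) * t + (bil p A e e - m) * t\<^sup>2" for t
    proof -
      let ?w = "\<lambda>k. v k + t * e k"
      have "bil p A ?w ?w = m + 2 * t * bil p A e v + t\<^sup>2 * bil p A e e"
        using bil_sym[of p A e v, OF sym] by (simp add: bil_simps m_def power2_eq_square)
      moreover have "bil p A e v = (\<Sum>k<p. A i k * v k)" by (simp add: bil_matrix_vector e)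
      moreover have "(norm2 p ?w)\<^sup>2 = (norm2 p v)\<^sup>2 + 2 * t * (\<Sum>k<p. e k * v k) + t\<^sup>2 * (\<Sum>k<p. e k * e k)"
        unfolding norm2_sq by (simp add: power2_eq_square algebra_simps sum.distrib sum_distrib_left)
      then have "(norm2 p ?w)\<^sup>2 = 1 + 2 * t * v i + t\<^sup>2"
        unfolding e by (simp add: v(1) e_def)
      ultimately show ?thesis using min[of ?w] by (simp add: algebra_simps)
    qed
    then have "2 * ((\<Sum>k<p. A i k * v k) - m * v i) = 0" by (rule linear_coeff_zero)
    then show ?thesis by simp
  qed
  with v(1) show ?thesis using min by (rule that)
qed

text \<open>\<open>lambda_max\<close> is a real supremum and bounds its members only if the set is
  bounded. The eigenvalue equation at a coordinate of largest modulus bounds the eigenvalue by a row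
  sum of absolute values.\<close>

lemma eigenvalues_bdd_above: "bdd_above (mat_eigenvalues p A)"
proof (rule bdd_aboveI)
  fix \<mu> assume "\<mu> \<in> mat_eigenvalues p A"
  then obtain v where v: "\<exists>k<p. v k \<noteq> 0" "\<forall>i<p. (\<Sum>k<p. A i k * v k) = \<mu> * v i"
    by (auto simp: mat_eigenvalues_def)
  define M where "M = Max ((\<lambda>k. \<bar>v k\<bar>) ` {..<p})"
  have "M \<in> (\<lambda>k. \<bar>v k\<bar>) ` {..<p}" unfolding M_def using v(1) by (intro Max_in) auto
  then obtain i where i: "i < p" "\<bar>v i\<bar> = M" by auto
  have M: "\<bar>v k\<bar> \<le> M" if "k < p" for k using that by (simp add: M_def)
  obtain k where k: "k < p" "v k \<noteq> 0" using v(1) by blast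
  have Mpos: "M > 0" using M[OF k(1)] k(2) by linarith
  have "\<mu> * M \<le> \<bar>\<mu> * v i\<bar>" using i Mpos by (simp add: abs_mult mult_right_mono)
  also have "\<dots> \<le> (\<Sum>k<p. \<bar>A i k\<bar> * M)"
    unfolding v(2)[rule_format, OF i(1), symmetric] using M
    by (intro order_trans[OF sum_abs] sum_mono) (simp add: abs_mult mult_left_mono)
  also have "\<dots> = (\<Sum>k<p. \<bar>A i k\<bar>) * M" by (simp add: sum_distrib_right)
  finally have "\<mu> \<le> (\<Sum>k<p. \<bar>A i k\<bar>)" using Mpos by simp
  also have "\<dots> \<le> (\<Sum>i<p. \<Sum>k<p. \<bar>A i k\<bar>)"
    using i by (intro member_le_sum) (auto intro: sum_nonneg)
  finally show "\<mu> \<le> (\<Sum>i<p. \<Sum>k<p. \<bar>A i k\<bar>)" .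
qed

text \<open>The form of \<open>S\<close> at columns a and b of \<open>T\<close> evaluates to the
  entry (b,a) of \<open>T\<close>, so symmetry passes from \<open>S\<close> to
  \<open>T\<close>.\<close>

lemma right_inverse_sym:
  fixes S T :: "nat \<Rightarrow> nat \<Rightarrow> real"
  assumes sym: "\<And>a b. a < p \<Longrightarrow> b < p \<Longrightarrow> S a b = S b a"
    and inv: "\<And>i j. i < p \<Longrightarrow> j < p \<Longrightarrow> (\<Sum>k<p. S i k * T k j) = (if i = j then 1 else 0)"
    and ij: "i < p" "j < p"
  shows "T i j = T j i"
proof -
  have "bil p S (\<lambda>k. T k a) (\<lambda>k. T k b) = T b a" if "a < p" "b < p" for a b
    using that by (simp add: bil_matrix_vector inv if_distrib[of "\<lambda>y. _ * y"] cong: if_cong)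
  then show ?thesis using bil_sym[of p S, OF sym] ij by metis
qed

text \<open>The spectral bound concerns the precision matrix \<open>T\<close>, while the Lasso
  analysis needs a lower bound for \<open>S\<close>. An eigenvector of \<open>S\<close> for its
  smallest eigenvalue m is an eigenvector of \<open>T\<close> for 1/m, hence 1/m \<le> L.\<close>

lemma inverse_rayleigh_lower:
  fixes S T :: "nat \<Rightarrow> nat \<Rightarrow> real"
  assumes p: "p \<ge> 1" and L: "L > 0"
    and sym: "\<And>a b. a < p \<Longrightarrow> b < p \<Longrightarrow> S a b = S b a"
    and psd: "\<And>v. 0 \<le> bil p S v v"
    and inv: "\<And>i j. i < p \<Longrightarrow> j < p \<Longrightarrow> (\<Sum>k<p. S i k * T k j) = (if i = j then 1 else 0)"
    and max: "lambda_max p T \<le> L"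
  shows "(norm2 p v)\<^sup>2 / L \<le> bil p S v v"
proof -
  obtain u m where u: "norm2 p u = 1" "\<And>i. i < p \<Longrightarrow> (\<Sum>k<p. S i k * u k) = m * u i"
    and m: "\<And>w. m * (norm2 p w)\<^sup>2 \<le> bil p S w w"
    using ex_min_eigenvector[of p S, OF p sym] by blast
  have "bil p S u u = (\<Sum>k<p. u k * (m * u k))" by (simp add: bil_matrix_vector u(2))
  also have "\<dots> = m * (norm2 p u)\<^sup>2"
    unfolding norm2_sq sum_distrib_left by (simp add: power2_eq_square mult_ac)
  finally have m0: "m \<ge> 0" using psd[of u] u(1) by simp
  have "L2_set u {..<p} \<noteq> 0" using u(1) by simp
  then obtain j where j: "j < p" "u j \<noteq> 0" by (auto simp: L2_set_eq_0_iff)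
  \<comment> \<open>Stated without division because the identity at the coordinate \<open>j\<close>,
    where \<open>u\<close> is nonzero, is also what excludes m = 0.\<close>
  have Tu: "m * (\<Sum>k<p. T i k * u k) = u i" if i: "i < p" for i
  proof -
    have "m * (\<Sum>k<p. T i k * u k) = (\<Sum>k<p. T k i * (m * u k))"
      unfolding sum_distrib_left
      by (intro sum.cong) (use right_inverse_sym[of p S T, OF sym inv] i in auto)
    also have "\<dots> = bil p S (\<lambda>k. T k i) u" by (simp add: bil_matrix_vector u(2))
    also have "\<dots> = bil p S u (\<lambda>k. T k i)" by (rule bil_sym[OF sym])
    also have "\<dots> = u i" using i by (simp add: bil_matrix_vector inv if_distrib[of "\<lambda>y. _ * y"] cong: if_cong)
    finally show ?thesis .
  qed
  have mpos: "m > 0" using m0 Tu[OF j(1)] j(2) by (cases "m = 0") auto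
  have "1 / m \<in> mat_eigenvalues p T"
    unfolding mat_eigenvalues_def using j Tu mpos
    by (auto intro!: exI[of _ u] simp: field_simps)
  from cSup_upper[OF this eigenvalues_bdd_above] have "1 / m \<le> L"
    using max unfolding lambda_max_def by linarith
  then have "1 / L \<le> m" using mpos L by (simp add: field_simps)
  then have "1 / L * (norm2 p v)\<^sup>2 \<le> m * (norm2 p v)\<^sup>2" by (intro mult_right_mono) auto
  then show ?thesis using m[of v] by simp
qed

subsection \<open>Oracle inequality for the nodewise Lasso\<close>

text \<open>Rates of the Lasso errors in terms of the constants of the locale \<open>good_design\<close> below: \<open>H\<close>
  bounds \<open>L\<close> and \<open>K\<^sup>2\<close>; with \<open>\<rho> = sqrt (log p / n)\<close>, \<open>a \<rho>\<close> bounds the entries of \<open>\<Delta> \<Theta>0\<close> and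
  \<open>\<Theta>0' \<Delta> \<Theta>0\<close>, and \<open>b \<rho>\<close> the penalties \<open>\<lambda>_j\<close>.\<close>

definition tau_rate :: "real \<Rightarrow> real \<Rightarrow> real \<Rightarrow> real" where
  "tau_rate H a b = H\<^sup>2 * a + 2 * b * H\<^sup>2 + 24 * H * b\<^sup>2"

definition l1_rate :: "real \<Rightarrow> real \<Rightarrow> real \<Rightarrow> real" where
  "l1_rate H a b = 48 * H\<^sup>2 * b + 2 * H ^ 4 * tau_rate H a b"

definition pred_rate :: "real \<Rightarrow> real \<Rightarrow> real \<Rightarrow> real" where
  "pred_rate H a b = 144 * H ^ 3 * b\<^sup>2 + 8 * H ^ 4 * (tau_rate H a b)\<^sup>2 * (H + H\<^sup>2 * a)"

section \<open>Residuals as quadratic forms, and the deterministic Lasso analysis\<close>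

lemma bil_Sigma_hat:
  "bil p (Sigma_hat n x) u w = (\<Sum>r<n. (\<Sum>k<p. u k * x r k) * (\<Sum>l<p. w l * x r l)) / real n"
proof -
  have "bil p (Sigma_hat n x) u w = (\<Sum>k<p. \<Sum>l<p. \<Sum>r<n. (u k * x r k) * (w l * x r l)) / real n"
    by (simp add: bil_def Sigma_hat_def sum_divide_distrib sum_distrib_left sum_distrib_right mult_ac)
  also have "(\<Sum>k<p. \<Sum>l<p. \<Sum>r<n. (u k * x r k) * (w l * x r l))
      = (\<Sum>k<p. \<Sum>r<n. \<Sum>l<p. (u k * x r k) * (w l * x r l))"
    by (intro sum.cong refl sum.swap)
  also have "\<dots> = (\<Sum>r<n. \<Sum>k<p. \<Sum>l<p. (u k * x r k) * (w l * x r l))" by (rule sum.swap)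
  finally show ?thesis by (simp add: sum_product)
qed

lemma Sigma_hat_sym: "Sigma_hat n x a b = Sigma_hat n x b a"
  by (simp add: Sigma_hat_def mult.commute)

lemma bil_Sigma_hat_nonneg: "0 \<le> bil p (Sigma_hat n x) u u"
  by (simp add: bil_Sigma_hat sum_nonneg)

lemma abs_bil_Sigma_hat_le:
  "\<bar>bil p (Sigma_hat n x) u w\<bar> \<le> (bil p (Sigma_hat n x) u u + bil p (Sigma_hat n x) w w) / 2"
  using bil_Sigma_hat_nonneg[of p n x "\<lambda>k. u k + w k"] bil_Sigma_hat_nonneg[of p n x "\<lambda>k. u k - w k"]
    bil_sym[of p "Sigma_hat n x" u w, OF Sigma_hat_sym]
  by (simp add: bil_simps)

lemma resid_sq_eq_bil:
  assumes "j < p"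
  shows "resid_sq n p x j \<gamma> = bil p (Sigma_hat n x) (Gamma_hat j \<gamma>) (Gamma_hat j \<gamma>)"
proof -
  have "(\<Sum>k<p. Gamma_hat j \<gamma> k * x r k) = x r j - (\<Sum>k\<in>{..<p} - {j}. x r k * \<gamma> k)" for r
  proof -
    have "(\<Sum>k<p. Gamma_hat j \<gamma> k * x r k) = x r j + (\<Sum>k\<in>{..<p} - {j}. Gamma_hat j \<gamma> k * x r k)"
      using assms by (subst sum.remove[of _ j]) (auto simp: Gamma_hat_def)
    also have "(\<Sum>k\<in>{..<p} - {j}. Gamma_hat j \<gamma> k * x r k) = (\<Sum>k\<in>{..<p} - {j}. - (x r k * \<gamma> k))"
      by (intro sum.cong) (auto simp: Gamma_hat_def)
    finally show ?thesis by (simp add: sum_negf)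
  qed
  then show ?thesis by (simp add: resid_sq_def bil_Sigma_hat power2_eq_square)
qed

text \<open>The population side, with one constant \<open>H\<close> standing for both
  \<open>L\<close> and K^2. From the two bounds on \<open>Sg\<close> all size bounds on the columns
  of its inverse follow.\<close>

locale precision_pair =
  fixes p :: nat and Sg Th :: "nat \<Rightarrow> nat \<Rightarrow> real" and H :: real
  assumes H1: "H \<ge> 1"
    and Sg_sym: "\<And>i j. i < p \<Longrightarrow> j < p \<Longrightarrow> Sg i j = Sg j i"
    and Sg_inv: "\<And>i j. i < p \<Longrightarrow> j < p \<Longrightarrow> (\<Sum>k<p. Sg i k * Th k j) = (if i = j then 1 else 0)"
    and Sg_lower: "\<And>v. (norm2 p v)\<^sup>2 / H \<le> bil p Sg v v"
    and Sg_diag: "\<And>j. j < p \<Longrightarrow> Sg j j \<le> H"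
begin

abbreviation "\<theta> j \<equiv> \<lambda>k. Th k j"

lemma bil_Sg_col: "j < p \<Longrightarrow> bil p Sg u (\<theta> j) = u j"
  by (simp add: bil_matrix_vector Sg_inv if_distrib[of "\<lambda>y. _ * y"] cong: if_cong)

lemma Th_bounds:
  assumes j: "j < p"
  shows "Th j j > 0" "Th j j \<le> H" "1 / Th j j \<le> H" "norm2 p (\<theta> j) \<le> H"
proof -
  \<comment> \<open>The form of \<open>Sg\<close> at its own inverse column equals the diagonal
    entry of that column, so a quadratic quantity is bounded by a linear one and both norm and
    diagonal are at most \<open>H\<close>.\<close>
  have q: "(norm2 p (\<theta> j))\<^sup>2 \<le> H * Th j j"
    using Sg_lower[of "\<theta> j"] bil_Sg_col[OF j] H1 by (simp add: field_simps)
  have d: "\<bar>Th j j\<bar> \<le> norm2 p (\<theta> j)"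
    using member_le_L2_set[of "{..<p}" j "\<lambda>k. \<bar>Th k j\<bar>"] j by (simp add: L2_set_def)
  have "norm2 p (\<theta> j) \<noteq> 0"
    using Sg_inv[OF j j] by (fastforce simp: L2_set_eq_0_iff)
  then have "(norm2 p (\<theta> j))\<^sup>2 > 0" by simp
  then have "H * Th j j > 0" using q by linarith
  then show pos: "Th j j > 0" using H1 by (simp add: zero_less_mult_iff)
  have "Th j j * Th j j \<le> (norm2 p (\<theta> j))\<^sup>2"
    using d pos by (simp add: power2_eq_square mult_mono)
  then have "Th j j * Th j j \<le> H * Th j j" using q by linarith
  then show le: "Th j j \<le> H" using pos by simp
  have "H * Th j j \<le> H\<^sup>2" using mult_left_mono[OF le, of H] H1 by (simp add: power2_eq_square)
  then have "(norm2 p (\<theta> j))\<^sup>2 \<le> H\<^sup>2" using q by linarith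
  then show "norm2 p (\<theta> j) \<le> H" using H1 power2_le_imp_le by simp
  \<comment> \<open>1 / Th j j is the residual variance of variable j given the others, hence at
    most its variance \<open>Sg j j\<close>; this is read off from the form at e_j - \<theta>_j / Th
    j j.\<close>
  define e where "e k = (if k = j then 1 else 0 :: real)" for k
  define t where "t = 1 / Th j j"
  have "0 \<le> bil p Sg (\<lambda>k. e k - t * Th k j) (\<lambda>k. e k - t * Th k j)"
    by (rule order_trans[OF _ Sg_lower]) (use H1 in simp)
  also have "\<dots> = bil p Sg e e - 2 * t * bil p Sg e (\<theta> j) + t\<^sup>2 * bil p Sg (\<theta> j) (\<theta> j)"
    using bil_sym[of p Sg "\<theta> j" e, OF Sg_sym] by (simp add: bil_simps power2_eq_square algebra_simps)
  also have "bil p Sg e e = Sg j j"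
    using j by (simp add: bil_matrix_vector e_def if_distrib[of "\<lambda>y. _ * y"] if_distrib[of "\<lambda>y. y * _"] cong: if_cong)
  also have "Sg j j - 2 * t * bil p Sg e (\<theta> j) + t\<^sup>2 * bil p Sg (\<theta> j) (\<theta> j) = Sg j j - t"
    using pos by (simp add: bil_Sg_col j e_def t_def power2_eq_square)
  finally show "1 / Th j j \<le> H" using Sg_diag[OF j] by (simp add: t_def)
qed

end

text \<open>What is required of a single sample. The factor 4 in \<open>RE\<close> is the cone
  constant produced by the Lasso. \<open>dev_quad\<close> is separate because deriving it from
  \<open>dev_col\<close> through the l1 norm of a column would lose a factor sqrt s.
  \<open>tau_small\<close> keeps every \<open>tau_hat_sq\<close> above 1 / (2H).\<close>

locale good_design = precision_pair p Sg Th H for p Sg Th H +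
  fixes n s :: nat and x :: "nat \<Rightarrow> nat \<Rightarrow> real" and a b \<rho> R :: real
  assumes s1: "s \<ge> 1" and a0: "a \<ge> 0" and b0: "b \<ge> 0" and \<rho>0: "\<rho> > 0"
    and sparse: "\<And>j. j < p \<Longrightarrow> card (supp p (\<lambda>k. Th k j)) \<le> s"
    and RE: "\<And>v. norm1 p v \<le> 4 * sqrt s * norm2 p v \<Longrightarrow>
        (norm2 p v)\<^sup>2 / (2 * H) \<le> bil p (Sigma_hat n x) v v"
    and dev_col: "\<And>k j. k < p \<Longrightarrow> j < p \<Longrightarrow> \<bar>\<Sum>l<p. (Sigma_hat n x k l - Sg k l) * Th l j\<bar> \<le> a * \<rho>"
    and dev_quad: "\<And>i j. i < p \<Longrightarrow> j < p \<Longrightarrow>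
        \<bar>bil p (\<lambda>k l. Sigma_hat n x k l - Sg k l) (\<lambda>k. Th k i) (\<lambda>k. Th k j)\<bar> \<le> a * \<rho>"
    and R_def: "R = sqrt s * \<rho>" and R1: "R \<le> 1" and tau_small: "tau_rate H a b * R \<le> 1 / (2 * H)"
begin

abbreviation "Sh \<equiv> Sigma_hat n x"
abbreviation "\<Delta> \<equiv> \<lambda>k l. Sigma_hat n x k l - Sg k l"

lemma R0: "R > 0" and \<rho>_le_R: "\<rho> \<le> R" and R_sq: "R\<^sup>2 = s * \<rho>\<^sup>2" and R_sqrt: "sqrt s * R = s * \<rho>"
  using s1 \<rho>0 by (auto simp: R_def power_mult_distrib mult_le_cancel_right1)

lemma bil_Delta: "bil p \<Delta> u w = bil p Sh u w - bil p Sg u w"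
  by (rule bil_diff_matrix)

context
  fixes j :: nat and \<gamma> :: "nat \<Rightarrow> real" and \<mu> :: real
  assumes j: "j < p" and lam: "2 * H * a * \<rho> \<le> \<mu>" "\<mu> \<le> b * \<rho>" "\<mu> > 0"
    and lasso: "is_nodewise_lasso n p x j \<mu> \<gamma>"
begin

text \<open>The population counterpart of \<open>Gamma_hat\<close>: away from \<open>j\<close> its
  entries are minus the coefficients of the best linear prediction of variable j.\<close>

definition "\<Gamma> k = Th k j / Th j j"
definition "v k = Gamma_hat j \<gamma> k - \<Gamma> k"
definition "A = (\<Sum>k\<in>supp p \<Gamma> - {j}. \<bar>v k\<bar>)"

lemma Gam_j: "\<Gamma> j = 1" and v_j: "v j = 0"
  using Th_bounds(1)[OF j] by (auto simp: \<Gamma>_def v_def Gamma_hat_def)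

lemma Gam_scale: "\<Gamma> = (\<lambda>k. (1 / Th j j) * Th k j)"
  by (simp add: \<Gamma>_def fun_eq_iff)

lemma Gam_true: "Gamma_hat j (\<lambda>k. - \<Gamma> k) = \<Gamma>"
  by (auto simp: Gamma_hat_def Gam_j fun_eq_iff)

lemma Gamma_hat_eq: "Gamma_hat j \<gamma> = (\<lambda>k. \<Gamma> k + v k)"
  by (simp add: v_def fun_eq_iff)

lemma supp_Gam: "card (supp p \<Gamma>) \<le> s"
  using sparse[OF j] Th_bounds(1)[OF j] by (simp add: \<Gamma>_def)

lemma norm1_Gam: "norm1 p \<Gamma> \<le> sqrt s * H\<^sup>2"
proof -
  have "norm2 p \<Gamma> = (1 / Th j j) * norm2 p (\<theta> j)"
    unfolding Gam_scale norm2_scale using Th_bounds(1)[OF j] by simp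
  also have "\<dots> \<le> H * H" using Th_bounds[OF j] H1 by (intro mult_mono) auto
  finally have "norm2 p \<Gamma> \<le> H\<^sup>2" by (simp add: power2_eq_square)
  then show ?thesis using norm1_supp_le[OF supp_Gam] mult_left_mono[of "norm2 p \<Gamma>" "H\<^sup>2" "sqrt s"] by simp
qed

text \<open>The population part vanishes, since \<open>Sg\<close> maps the j-th column to the j-th
  unit vector and v_j = 0. What remains is noise, and here the lower bound on the penalty is spent;
  this is where the large constant in front of \<lambda>_j is needed.\<close>

lemma cross_term: "\<bar>bil p Sh v \<Gamma>\<bar> \<le> \<mu> / 2 * norm1 p v"
proof -
  have "bil p Sh v \<Gamma> = (1 / Th j j) * bil p \<Delta> v (\<theta> j)"
    unfolding Gam_scale bil_scale_right bil_Delta by (simp add: bil_Sg_col j v_j)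
  moreover have "\<bar>bil p \<Delta> v (\<theta> j)\<bar> \<le> norm1 p v * (a * \<rho>)"
    by (rule abs_bil_le_norm1) (rule dev_col[OF _ j])
  ultimately have "\<bar>bil p Sh v \<Gamma>\<bar> \<le> (1 / Th j j) * (norm1 p v * (a * \<rho>))"
    using Th_bounds(1)[OF j] by (simp add: abs_mult mult_left_mono divide_right_mono)
  also have "\<dots> \<le> H * (norm1 p v * (a * \<rho>))"
    using Th_bounds(3)[OF j] a0 \<rho>0 by (intro mult_right_mono) (auto intro!: mult_nonneg_nonneg sum_nonneg)
  also have "\<dots> = (H * a * \<rho>) * norm1 p v" by simp
  also have "\<dots> \<le> \<mu> / 2 * norm1 p v" using lam(1) by (intro mult_right_mono) (auto intro: sum_nonneg)
  finally show ?thesis .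
qed

lemma resid_expand: "resid_sq n p x j \<gamma> = bil p Sh \<Gamma> \<Gamma> + 2 * bil p Sh v \<Gamma> + bil p Sh v v"
  using bil_sym[of p Sh \<Gamma> v, OF Sigma_hat_sym] by (simp add: resid_sq_eq_bil j Gamma_hat_eq bil_simps)

lemma basic_inequality:
  "resid_sq n p x j \<gamma> + 2 * \<mu> * l1_off p j \<gamma> \<le> bil p Sh \<Gamma> \<Gamma> + 2 * \<mu> * l1_off p j \<Gamma>"
  \<comment> \<open>The competitor is the vector of population regression coefficients, which
    carries the opposite sign of \<open>\<Gamma>\<close>.\<close>
  using lasso[unfolded is_nodewise_lasso_def, THEN spec, of "\<lambda>k. - \<Gamma> k"]
  by (simp add: lasso_obj_def resid_sq_eq_bil[OF j, of _ _ "\<lambda>k. - \<Gamma> k"] Gam_true l1_off_def)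

text \<open>On the support of \<open>\<Gamma>\<close> the difference of penalties costs at most
  |v_k|, off the support it gains exactly |v_k|. With weight 2\<mu> this leaves 2\<mu> (2A - |v|_1),
  and the cross term gives back \<mu> |v|_1.\<close>

lemma cone: "bil p Sh v v + \<mu> * (norm1 p v - A) \<le> 3 * \<mu> * A"
proof -
  let ?P = "{..<p} - {j}" and ?S = "supp p \<Gamma> - {j}"
  have n1: "norm1 p v = (\<Sum>k\<in>?P. \<bar>v k\<bar>)"
    using j by (subst sum.remove[of _ j]) (auto simp: v_j)
  have nA: "norm1 p v - A = (\<Sum>k\<in>?P - ?S. \<bar>v k\<bar>)"
    unfolding n1 A_def by (subst sum_diff) auto
  have "l1_off p j \<Gamma> - l1_off p j \<gamma> = (\<Sum>k\<in>?P. \<bar>\<Gamma> k\<bar> - \<bar>\<Gamma> k + v k\<bar>)"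
    unfolding l1_off_def by (auto simp: sum_subtractf[symmetric] v_def Gamma_hat_def intro!: sum.cong)
  also have "\<dots> \<le> (\<Sum>k\<in>?P. if k \<in> ?S then \<bar>v k\<bar> else - \<bar>v k\<bar>)"
    by (intro sum_mono) auto
  also have "\<dots> = (\<Sum>k\<in>?P \<inter> ?S. \<bar>v k\<bar>) + (\<Sum>k\<in>?P \<inter> - ?S. - \<bar>v k\<bar>)"
    by (simp only: sum.If_cases finite_Diff finite_lessThan Collect_mem_eq)
  also have "?P \<inter> ?S = ?S" by auto
  also have "?P \<inter> - ?S = ?P - ?S" by auto
  also have "(\<Sum>k\<in>?S. \<bar>v k\<bar>) + (\<Sum>k\<in>?P - ?S. - \<bar>v k\<bar>) = A - (norm1 p v - A)"
    unfolding nA by (simp add: A_def sum_negf)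
  finally have "2 * \<mu> * (l1_off p j \<Gamma> - l1_off p j \<gamma>) \<le> 2 * \<mu> * (2 * A - norm1 p v)"
    using lam(3) by (intro mult_left_mono) auto
  moreover have "- (2 * bil p Sh v \<Gamma>) \<le> \<mu> * norm1 p v" using cross_term by (simp add: abs_le_iff)
  ultimately show ?thesis using basic_inequality unfolding resid_expand by (simp add: algebra_simps)
qed

lemma A_le: "A \<le> sqrt s * norm2 p v"
proof -
  have "A \<le> sqrt s * L2_set v (supp p \<Gamma> - {j})"
    unfolding A_def using supp_Gam by (intro norm1_sparse_le) (auto intro: le_trans[OF card_Diff1_le])
  also have "\<dots> \<le> sqrt s * norm2 p v" by (intro mult_left_mono L2_set_le_norm2) auto
  finally show ?thesis .
qed

text \<open>The cone bound |v|_1 \<le> 4A makes \<open>RE\<close> applicable, and the form at v is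
  at most 3\<mu>A with A \<le> sqrt s |v|_2. Comparing the two gives |v|_2 \<le> 6H\<mu> sqrt s, so
  A \<le> 6H\<mu>s; multiplying by 4 and by 3\<mu> yields both constants.\<close>

lemma lasso_error:
  shows "norm1 p v \<le> 24 * H * \<mu> * s" "bil p Sh v v \<le> 18 * H * \<mu>\<^sup>2 * s"
proof -
  have "\<mu> * (norm1 p v - A) \<le> \<mu> * (3 * A)" using cone bil_Sigma_hat_nonneg[of p n x v] by simp
  then have n4: "norm1 p v \<le> 4 * A" using lam(3) by simp
  have An: "A \<le> norm1 p v" unfolding A_def by (intro sum_mono2) auto
  then have "0 \<le> \<mu> * (norm1 p v - A)" using lam(3) by simp
  then have qA: "bil p Sh v v \<le> 3 * \<mu> * A" using cone by linarith
  have "(norm2 p v)\<^sup>2 / (2 * H) \<le> bil p Sh v v" using n4 A_le by (intro RE) linarith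
  also have "\<dots> \<le> 3 * \<mu> * (sqrt s * norm2 p v)"
    using lam(3) by (intro order_trans[OF qA] mult_left_mono A_le) auto
  finally have "norm2 p v * norm2 p v \<le> (6 * H * \<mu> * sqrt s) * norm2 p v"
    using H1 by (simp add: field_simps power2_eq_square)
  then have "norm2 p v \<le> 6 * H * \<mu> * sqrt s"
    using H1 lam(3) L2_set_nonneg[of v "{..<p}"] by (cases "norm2 p v = 0") auto
  then have "sqrt s * norm2 p v \<le> sqrt s * (6 * H * \<mu> * sqrt s)" by (intro mult_left_mono) auto
  also have "sqrt s * (6 * H * \<mu> * sqrt s) = 6 * H * \<mu> * s" by simp
  finally have A: "A \<le> 6 * H * \<mu> * s" using A_le by linarith
  show "norm1 p v \<le> 24 * H * \<mu> * s" using n4 A by simp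
  show "bil p Sh v v \<le> 18 * H * \<mu>\<^sup>2 * s"
  proof -
    have "3 * \<mu> * A \<le> 3 * \<mu> * (6 * H * \<mu> * s)" using A lam(3) by (intro mult_left_mono) auto
    also have "\<dots> = 18 * H * \<mu>\<^sup>2 * s" by (simp add: power2_eq_square)
    finally show ?thesis using qA by linarith
  qed
qed

lemma norm1_v: "norm1 p v \<le> 24 * H * b * (s * \<rho>)"
proof -
  have "24 * H * \<mu> * s \<le> 24 * H * (b * \<rho>) * s" using lam H1 by (intro mult_right_mono mult_left_mono) auto
  then show ?thesis using lasso_error(1) by (simp only: mult_ac)
qed

lemma pred_v: "bil p Sh v v \<le> 18 * H * b\<^sup>2 * R\<^sup>2"
proof -
  have "\<mu>\<^sup>2 \<le> (b * \<rho>)\<^sup>2" using lam by (intro power_mono) auto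
  then have "18 * H * \<mu>\<^sup>2 * s \<le> 18 * H * (b * \<rho>)\<^sup>2 * s" using H1 by (intro mult_right_mono mult_left_mono) auto
  then show ?thesis using lasso_error(2) by (simp add: R_sq power_mult_distrib mult_ac)
qed

lemma quad_Gam: "\<bar>bil p Sh \<Gamma> \<Gamma> - 1 / Th j j\<bar> \<le> H\<^sup>2 * a * \<rho>"
proof -
  have "bil p Sh \<Gamma> \<Gamma> - 1 / Th j j = (1 / Th j j)\<^sup>2 * bil p \<Delta> (\<theta> j) (\<theta> j)"
    unfolding Gam_scale bil_scale_left bil_scale_right bil_Delta bil_Sg_col[OF j]
    using Th_bounds(1)[OF j] by (simp add: field_simps power2_eq_square)
  also have "\<bar>\<dots>\<bar> \<le> H\<^sup>2 * (a * \<rho>)"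
    unfolding abs_mult using Th_bounds[OF j] dev_quad[OF j j]
    by (intro mult_mono) (auto intro: power_mono)
  finally show ?thesis by simp
qed

text \<open>From above, the basic inequality compares with the form at \<open>\<Gamma>\<close>, and
  |\<open>\<Gamma>\<close>|_1 of order sqrt s makes the penalty of order \<open>R\<close>. From
  below, the residual is expanded around \<open>\<Gamma>\<close> and the nonnegative terms are
  dropped.\<close>

lemma tau_hat_error: "\<bar>tau_hat_sq n p x j \<mu> \<gamma> - 1 / Th j j\<bar> \<le> tau_rate H a b * R"
proof -
  let ?t = "tau_hat_sq n p x j \<mu> \<gamma>"
  have aR: "H\<^sup>2 * a * \<rho> \<le> H\<^sup>2 * a * R" using \<rho>_le_R a0 by (intro mult_left_mono) auto
  have l0: "0 \<le> \<mu> * l1_off p j \<gamma>" using lam(3) by (simp add: l1_off_def sum_nonneg)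
  have "l1_off p j \<Gamma> \<le> norm1 p \<Gamma>" unfolding l1_off_def by (intro sum_mono2) auto
  then have lG: "l1_off p j \<Gamma> \<le> sqrt s * H\<^sup>2" using norm1_Gam by linarith
  have "\<mu> * l1_off p j \<Gamma> \<le> (b * \<rho>) * (sqrt s * H\<^sup>2)"
    using lam b0 \<rho>0 lG by (intro mult_mono) (auto simp: l1_off_def intro: sum_nonneg)
  also have "\<dots> = b * H\<^sup>2 * R" by (simp add: R_def)
  finally have "?t \<le> bil p Sh \<Gamma> \<Gamma> + 2 * b * H\<^sup>2 * R"
    using basic_inequality l0 unfolding tau_hat_sq_def by simp
  then have up: "?t - 1 / Th j j \<le> H\<^sup>2 * a * R + 2 * b * H\<^sup>2 * R" using quad_Gam aR by linarith
  have "\<mu> * norm1 p v \<le> (b * \<rho>) * (24 * H * b * (s * \<rho>))"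
    using lam b0 \<rho>0 norm1_v by (intro mult_mono) (auto intro: sum_nonneg)
  also have "\<dots> = 24 * H * b\<^sup>2 * R\<^sup>2" unfolding R_sq by (simp add: power2_eq_square)
  \<comment> \<open>The Lasso term is of order R^2; R \<le> 1 reduces it to the common rate.\<close>
  also have "\<dots> \<le> 24 * H * b\<^sup>2 * R"
    using R0 R1 H1 by (intro mult_left_mono) (auto simp: power2_eq_square mult_le_cancel_right1)
  finally have "- (2 * bil p Sh v \<Gamma>) \<le> 24 * H * b\<^sup>2 * R" using cross_term by linarith
  moreover have "?t \<ge> bil p Sh \<Gamma> \<Gamma> + 2 * bil p Sh v \<Gamma>"
    unfolding tau_hat_sq_def resid_expand using l0 bil_Sigma_hat_nonneg[of p n x v] by linarith
  ultimately have lo: "1 / Th j j - ?t \<le> H\<^sup>2 * a * R + 24 * H * b\<^sup>2 * R" using quad_Gam aR by linarith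
  have "0 \<le> 2 * b * H\<^sup>2 * R" "0 \<le> 24 * H * b\<^sup>2 * R" using b0 R0 H1 by auto
  then show ?thesis using up lo unfolding tau_rate_def distrib_right by linarith
qed

lemma column_error:
  fixes d
  defines "d \<equiv> \<lambda>k. Gamma_hat j \<gamma> k / tau_hat_sq n p x j \<mu> \<gamma> - Th k j"
  shows "norm1 p d \<le> l1_rate H a b * (s * \<rho>)" "bil p Sh d d \<le> pred_rate H a b * R\<^sup>2"
proof -
  define t where "t = tau_hat_sq n p x j \<mu> \<gamma>"
  define t0 where "t0 = 1 / Th j j"
  define E where "E = tau_rate H a b"
  define \<delta> where "\<delta> = 1 / t - 1 / t0"
  have err: "\<bar>t - t0\<bar> \<le> E * R" using tau_hat_error by (simp add: t_def t0_def E_def)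
  have E0: "E \<ge> 0" using a0 b0 H1 by (simp add: E_def tau_rate_def)
  have t0: "t0 > 0" "1 / t0 \<le> H" "t0 \<le> H" "1 / H \<le> t0"
    using Th_bounds[OF j] H1 by (auto simp: t0_def field_simps)
  \<comment> \<open>\<open>t0\<close> is at least 1/H, and \<open>tau_small\<close> allows the
    estimate to lose at most half of this.\<close>
  have t_lo: "1 / (2 * H) \<le> t"
    using err tau_small t0(4) by (simp add: E_def abs_le_iff)
  moreover have "1 / (2 * H) > 0" using H1 by simp
  ultimately have tpos: "t > 0" by linarith
  have t: "t > 0" "1 / t \<le> 2 * H" using t_lo tpos H1 by (auto simp: field_simps)
  have "\<bar>\<delta>\<bar> = \<bar>t - t0\<bar> * (1 / t) * (1 / t0)"
  proof -
    have "\<delta> = (t0 - t) * (1 / t) * (1 / t0)" using t t0 by (simp add: \<delta>_def field_simps)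
    then show ?thesis using t t0 by (simp only: abs_mult) (simp add: abs_minus_commute)
  qed
  also have "\<dots> \<le> (E * R) * (2 * H) * H"
    using err t t0 E0 R0 by (intro mult_mono) auto
  finally have \<delta>: "\<bar>\<delta>\<bar> \<le> 2 * H\<^sup>2 * E * R" by (simp add: power2_eq_square mult_ac)
  \<comment> \<open>The column error splits into the rescaled Lasso error and the error of the
    normaliser. The latter is of order R times the l1 norm of \<open>\<Gamma>\<close>, that is R
    sqrt s = s \<rho>, the same l1 rate as the former.\<close>
  have d: "d = (\<lambda>k. (1 / t) * v k + \<delta> * \<Gamma> k)"
    using t t0 Th_bounds(1)[OF j]
    by (auto simp: d_def t_def[symmetric] v_def \<delta>_def t0_def \<Gamma>_def fun_eq_iff field_simps)
  have "norm1 p d \<le> (\<Sum>k<p. (1 / t) * \<bar>v k\<bar> + \<bar>\<delta>\<bar> * \<bar>\<Gamma> k\<bar>)"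
    unfolding d using t by (intro sum_mono) (auto simp: abs_mult intro!: order_trans[OF abs_triangle_ineq])
  also have "\<dots> = (1 / t) * norm1 p v + \<bar>\<delta>\<bar> * norm1 p \<Gamma>"
    by (simp add: sum.distrib sum_distrib_left)
  also have "\<dots> \<le> (2 * H) * (24 * H * b * (s * \<rho>)) + (2 * H\<^sup>2 * E * R) * (sqrt s * H\<^sup>2)"
    using t \<delta> norm1_v norm1_Gam H1 E0 R0 by (intro add_mono mult_mono) (auto intro: sum_nonneg)
  also have "\<dots> = 48 * H\<^sup>2 * b * (s * \<rho>) + 2 * H ^ 4 * E * (sqrt s * R)"
    by (simp add: power2_eq_square power4_eq_xxxx)
  also have "\<dots> = l1_rate H a b * (s * \<rho>)"
    unfolding R_sqrt by (simp add: l1_rate_def E_def distrib_right)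
  finally show "norm1 p d \<le> l1_rate H a b * (s * \<rho>)" .
  let ?u = "\<lambda>k. (1 / t) * v k" and ?w = "\<lambda>k. \<delta> * \<Gamma> k"
  have "bil p Sh d d = bil p Sh ?u ?u + bil p Sh ?w ?w + 2 * bil p Sh ?u ?w"
    unfolding d bil_add_left bil_add_right using bil_sym[of p Sh ?w ?u, OF Sigma_hat_sym] by simp
  also have "\<dots> \<le> 2 * bil p Sh ?u ?u + 2 * bil p Sh ?w ?w"
    using abs_bil_Sigma_hat_le[of p n x ?u ?w] by (simp add: abs_le_iff)
  also have "\<dots> = 2 * (1 / t)\<^sup>2 * bil p Sh v v + 2 * \<bar>\<delta>\<bar>\<^sup>2 * bil p Sh \<Gamma> \<Gamma>"
    unfolding bil_scale_left bil_scale_right by (simp add: power2_eq_square)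
  also have "\<dots> \<le> 2 * (2 * H)\<^sup>2 * (18 * H * b\<^sup>2 * R\<^sup>2) + 2 * (2 * H\<^sup>2 * E * R)\<^sup>2 * (H + H\<^sup>2 * a)"
  proof (intro add_mono mult_mono power_mono)
    have "H\<^sup>2 * a * \<rho> \<le> H\<^sup>2 * a * 1" using \<rho>_le_R R1 a0 by (intro mult_left_mono) auto
    then show "bil p Sh \<Gamma> \<Gamma> \<le> H + H\<^sup>2 * a" using quad_Gam t0(3) by (simp add: t0_def abs_le_iff)
  qed (use t \<delta> pred_v bil_Sigma_hat_nonneg H1 in auto)
  also have "\<dots> = pred_rate H a b * R\<^sup>2"
    by (simp add: pred_rate_def E_def power2_eq_square power3_eq_cube power4_eq_xxxx algebra_simps)
  finally show "bil p Sh d d \<le> pred_rate H a b * R\<^sup>2" .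
qed

end

lemma T_hat_expansion:
  assumes ij: "i < p" "j < p"
    and lam: "\<And>j. j < p \<Longrightarrow> 2 * H * a * \<rho> \<le> lam j" "\<And>j. j < p \<Longrightarrow> lam j \<le> b * \<rho>" "\<And>j. j < p \<Longrightarrow> lam j > 0"
    and lasso: "\<And>j. j < p \<Longrightarrow> is_nodewise_lasso n p x j (lam j) (\<gamma> j)"
  shows "\<bar>T_hat n p x lam \<gamma> i j - Th i j + bil p \<Delta> (\<theta> i) (\<theta> j)\<bar>
      \<le> (2 * a * l1_rate H a b + pred_rate H a b) * (s * \<rho>\<^sup>2)"
proof -
  define d where "d j k = Theta_hat n p x lam \<gamma> k j - Th k j" for j k
  have dj: "d j = (\<lambda>k. Gamma_hat j (\<gamma> j) k / tau_hat_sq n p x j (lam j) (\<gamma> j) - Th k j)" for j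
    by (simp add: d_def Theta_hat_def fun_eq_iff)
  have d1: "norm1 p (d j) \<le> l1_rate H a b * (s * \<rho>)"
    and d2: "bil p Sh (d j) (d j) \<le> pred_rate H a b * R\<^sup>2" if "j < p" for j
    unfolding dj using column_error[OF that lam[OF that] lasso[OF that]] by auto
  have th: "(\<lambda>k. Theta_hat n p x lam \<gamma> k j) = (\<lambda>k. Th k j + d j k)" for j
    by (simp add: d_def fun_eq_iff)
  have "T_hat n p x lam \<gamma> i j = (Th i j + d j i) + (Th j i + d i j)
      - bil p Sh (\<lambda>k. Th k i + d i k) (\<lambda>k. Th k j + d j k)"
    unfolding T_hat_def th[symmetric] bil_def by (simp add: d_def)
  also have "bil p Sh (\<lambda>k. Th k i + d i k) (\<lambda>k. Th k j + d j k)
      = bil p Sh (\<theta> i) (\<theta> j) + bil p Sh (\<theta> i) (d j) + bil p Sh (d i) (\<theta> j) + bil p Sh (d i) (d j)"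
    by (simp add: bil_add_left bil_add_right)
  \<comment> \<open>The cancellation: \<open>Th j i\<close> meets the transposed entry in
    \<open>T_hat\<close>, and in the next two steps the population parts \<open>d i j\<close> and
    \<open>d j i\<close> meet the errors of the two entries of \<open>Theta_hat\<close>.\<close>
  also have "bil p Sh (\<theta> i) (\<theta> j) = bil p \<Delta> (\<theta> i) (\<theta> j) + Th j i"
    using ij by (simp add: bil_Delta bil_Sg_col)
  also have "bil p Sh (d i) (\<theta> j) = bil p \<Delta> (d i) (\<theta> j) + d i j"
    using ij by (simp add: bil_Delta bil_Sg_col)
  also have "bil p Sh (\<theta> i) (d j) = bil p \<Delta> (d j) (\<theta> i) + d j i"
    using ij bil_sym[of p Sh "\<theta> i" "d j", OF Sigma_hat_sym] by (simp add: bil_Delta bil_Sg_col)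
  finally have T: "T_hat n p x lam \<gamma> i j - Th i j + bil p \<Delta> (\<theta> i) (\<theta> j)
      = - bil p \<Delta> (d j) (\<theta> i) - bil p \<Delta> (d i) (\<theta> j) - bil p Sh (d i) (d j)" by simp
  have cross: "\<bar>bil p \<Delta> (d k) (\<theta> l)\<bar> \<le> l1_rate H a b * (s * \<rho>) * (a * \<rho>)" if kl: "k < p" "l < p" for k l
  proof -
    have "\<bar>bil p \<Delta> (d k) (\<theta> l)\<bar> \<le> norm1 p (d k) * (a * \<rho>)"
      by (rule abs_bil_le_norm1) (rule dev_col[OF _ kl(2)])
    also have "\<dots> \<le> l1_rate H a b * (s * \<rho>) * (a * \<rho>)"
      using d1[OF kl(1)] a0 \<rho>0 by (intro mult_right_mono) auto
    finally show ?thesis .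
  qed
  \<comment> \<open>The quadratic remainder is kept in the empirical seminorm, where it is a
    prediction error of order R^2 = s \<rho>^2; an l1 bound would give only s^2 \<rho>^2 times the
    size of the entries of \<open>Sh\<close>.\<close>
  have "\<bar>bil p Sh (d i) (d j)\<bar> \<le> (bil p Sh (d i) (d i) + bil p Sh (d j) (d j)) / 2"
    by (rule abs_bil_Sigma_hat_le)
  also have "\<dots> \<le> (pred_rate H a b * R\<^sup>2 + pred_rate H a b * R\<^sup>2) / 2"
    using d2 ij by (intro divide_right_mono add_mono) auto
  finally have "\<bar>bil p Sh (d i) (d j)\<bar> \<le> pred_rate H a b * R\<^sup>2" by simp
  then have "\<bar>- bil p \<Delta> (d j) (\<theta> i) - bil p \<Delta> (d i) (\<theta> j) - bil p Sh (d i) (d j)\<bar>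
      \<le> 2 * (l1_rate H a b * (s * \<rho>) * (a * \<rho>)) + pred_rate H a b * R\<^sup>2"
    using cross[OF ij(1) ij(2)] cross[OF ij(2) ij(1)] by linarith
  also have "\<dots> = (2 * a * l1_rate H a b + pred_rate H a b) * (s * \<rho>\<^sup>2)"
    unfolding R_sq by (simp add: power2_eq_square algebra_simps)
  finally show ?thesis unfolding T .
qed

end

subsection \<open>Sub-Gaussian designs\<close>

abbreviation dev :: "nat \<Rightarrow> (nat \<Rightarrow> nat \<Rightarrow> real) \<Rightarrow> (nat \<Rightarrow> nat \<Rightarrow> real) \<Rightarrow> nat \<Rightarrow> nat \<Rightarrow> real" where
  "dev n x Sg \<equiv> \<lambda>k l. Sigma_hat n x k l - Sg k l"

text \<open>The Bernstein rate at B = K^2, the subexponential scale of a product of two linear forms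
  with coefficient vectors of norm at most 1.\<close>

definition bernstein_exponent :: "real \<Rightarrow> real \<Rightarrow> real" where
  "bernstein_exponent K t = min (t\<^sup>2 / (32 * (K\<^sup>2)\<^sup>2)) (t / (4 * K\<^sup>2))"

locale subgaussian_rows = prob_space \<mu> for \<mu> :: "(nat \<Rightarrow> real) measure" +
  fixes p :: nat and K :: real and Sg :: "nat \<Rightarrow> nat \<Rightarrow> real"
  assumes K0: "K > 0"
    and sets_\<mu>: "sets \<mu> = sets (PiM {..<p} (\<lambda>_. (borel :: real measure)))"
    and cov_int: "\<And>i j. i < p \<Longrightarrow> j < p \<Longrightarrow> integrable \<mu> (\<lambda>v. v i * v j)"
    and cov: "\<And>i j. i < p \<Longrightarrow> j < p \<Longrightarrow> (\<integral>v. v i * v j \<partial>\<mu>) = Sg i j"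
    and subg: "\<And>u. norm2 p u \<le> 1 \<Longrightarrow>
        (\<integral>\<^sup>+v. ennreal (exp ((\<Sum>j<p. u j * v j)\<^sup>2 / K\<^sup>2)) \<partial>\<mu>) \<le> 2"
begin

lemma coord_measurable[measurable]: "k < p \<Longrightarrow> (\<lambda>v. v k) \<in> borel_measurable \<mu>"
  by (subst measurable_cong_sets[OF sets_\<mu> refl]) (rule measurable_component_singleton, simp)

lemma lin_measurable[measurable]: "(\<lambda>v. \<Sum>j<p. u j * v j) \<in> borel_measurable \<mu>"
  by (intro borel_measurable_sum borel_measurable_times) auto

lemma Sg_sym: "i < p \<Longrightarrow> j < p \<Longrightarrow> Sg i j = Sg j i"
  by (simp add: mult.commute flip: cov)

lemma lin_prod:
  shows lin_prod_integrable: "integrable \<mu> (\<lambda>v. (\<Sum>k<p. u k * v k) * (\<Sum>l<p. w l * v l))"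
    and lin_prod_expectation: "expectation (\<lambda>v. (\<Sum>k<p. u k * v k) * (\<Sum>l<p. w l * v l)) = bil p Sg u w"
proof -
  have eq: "(\<lambda>v. (\<Sum>k<p. u k * v k) * (\<Sum>l<p. w l * v l)) = (\<lambda>v. \<Sum>k<p. \<Sum>l<p. (u k * w l) * (v k * v l))"
    by (simp add: sum_product mult_ac)
  have "has_bochner_integral \<mu> (\<lambda>v. \<Sum>k<p. \<Sum>l<p. (u k * w l) * (v k * v l))
      (\<Sum>k<p. \<Sum>l<p. (u k * w l) * Sg k l)"
    by (intro has_bochner_integral_sum has_bochner_integral_mult_right)
      (simp add: has_bochner_integral_iff cov cov_int)
  then have "has_bochner_integral \<mu> (\<lambda>v. (\<Sum>k<p. u k * v k) * (\<Sum>l<p. w l * v l)) (bil p Sg u w)"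
    unfolding eq by (simp add: bil_def mult_ac)
  then show "integrable \<mu> (\<lambda>v. (\<Sum>k<p. u k * v k) * (\<Sum>l<p. w l * v l))"
    and "expectation (\<lambda>v. (\<Sum>k<p. u k * v k) * (\<Sum>l<p. w l * v l)) = bil p Sg u w"
    by (simp_all add: has_bochner_integral_iff)
qed

text \<open>The arithmetic-geometric mean inequality is applied twice, to the product of the forms
  and to the exponentials, so that the bound 2 and the scale K^2 survive without loss.\<close>

lemma lin_prod_subexponential:
  assumes "norm2 p u \<le> 1" "norm2 p w \<le> 1"
  shows "(\<integral>\<^sup>+v. ennreal (exp (\<bar>(\<Sum>k<p. u k * v k) * (\<Sum>l<p. w l * v l)\<bar> / K\<^sup>2)) \<partial>\<mu>) \<le> 2"
proof -
  have am: "exp (\<bar>a * b\<bar> / K\<^sup>2) \<le> 1 / 2 * exp (a\<^sup>2 / K\<^sup>2) + 1 / 2 * exp (b\<^sup>2 / K\<^sup>2)" for a b :: real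
  proof -
    have "2 * \<bar>a * b\<bar> \<le> a\<^sup>2 + b\<^sup>2"
      using zero_le_power2[of "\<bar>a\<bar> - \<bar>b\<bar>"] by (simp add: power2_diff abs_mult)
    then have "\<bar>a * b\<bar> / K\<^sup>2 \<le> a\<^sup>2 / K\<^sup>2 / 2 + b\<^sup>2 / K\<^sup>2 / 2"
      using K0 by (simp add: field_simps)
    then have "exp (\<bar>a * b\<bar> / K\<^sup>2) \<le> exp (a\<^sup>2 / K\<^sup>2 / 2) * exp (b\<^sup>2 / K\<^sup>2 / 2)"
      by (simp flip: exp_add)
    also have "\<dots> \<le> ((exp (a\<^sup>2 / K\<^sup>2 / 2))\<^sup>2 + (exp (b\<^sup>2 / K\<^sup>2 / 2))\<^sup>2) / 2"
      using zero_le_power2[of "exp (a\<^sup>2 / K\<^sup>2 / 2) - exp (b\<^sup>2 / K\<^sup>2 / 2)"] by (simp add: power2_diff)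
    also have "\<dots> = 1 / 2 * exp (a\<^sup>2 / K\<^sup>2) + 1 / 2 * exp (b\<^sup>2 / K\<^sup>2)"
      by (simp add: exp_double[symmetric] add_divide_distrib)
    finally show ?thesis .
  qed
  let ?f = "\<lambda>u v. ennreal (exp ((\<Sum>k<p. u k * v k)\<^sup>2 / K\<^sup>2))"
  have "(\<integral>\<^sup>+v. ennreal (exp (\<bar>(\<Sum>k<p. u k * v k) * (\<Sum>l<p. w l * v l)\<bar> / K\<^sup>2)) \<partial>\<mu>)
      \<le> (\<integral>\<^sup>+v. ennreal (1 / 2) * ?f u v + ennreal (1 / 2) * ?f w v \<partial>\<mu>)"
  proof (rule nn_integral_mono)
    fix v
    have "ennreal (exp (\<bar>(\<Sum>k<p. u k * v k) * (\<Sum>l<p. w l * v l)\<bar> / K\<^sup>2))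
        \<le> ennreal (1 / 2 * exp ((\<Sum>k<p. u k * v k)\<^sup>2 / K\<^sup>2) + 1 / 2 * exp ((\<Sum>k<p. w k * v k)\<^sup>2 / K\<^sup>2))"
      by (rule ennreal_leI) (rule am)
    also have "\<dots> = ennreal (1 / 2) * ?f u v + ennreal (1 / 2) * ?f w v"
      by (subst ennreal_plus) (auto simp only: ennreal_mult'' exp_ge_zero, auto)
    finally show "ennreal (exp (\<bar>(\<Sum>k<p. u k * v k) * (\<Sum>l<p. w l * v l)\<bar> / K\<^sup>2))
        \<le> ennreal (1 / 2) * ?f u v + ennreal (1 / 2) * ?f w v" .
  qed
  also have "\<dots> = ennreal (1 / 2) * (\<integral>\<^sup>+v. ?f u v \<partial>\<mu>) + ennreal (1 / 2) * (\<integral>\<^sup>+v. ?f w v \<partial>\<mu>)"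
    by (subst nn_integral_add) (auto simp: nn_integral_cmult)
  also have "\<dots> \<le> ennreal (1 / 2) * 2 + ennreal (1 / 2) * 2"
    using assms by (intro add_mono mult_left_mono subg) auto
  also have "ennreal (1 / 2) * 2 = ennreal (1 / 2) * ennreal 2" by simp
  also have "\<dots> = 1" by (subst ennreal_mult[symmetric]) auto
  finally show ?thesis by simp
qed

lemma Sg_diag_le:
  assumes j: "j < p"
  shows "Sg j j \<le> K\<^sup>2"
proof -
  let ?e = "\<lambda>k. if k = j then 1 else 0 :: real"
  have lin: "(\<Sum>k<p. ?e k * v k) = v j" for v :: "nat \<Rightarrow> real"
    using j by (simp add: if_distrib[of "\<lambda>y. y * _"] cong: if_cong)
  have e1: "norm2 p ?e \<le> 1" using j by (simp add: L2_set_def if_distrib[of "\<lambda>y. y\<^sup>2"] cong: if_cong)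
  \<comment> \<open>Integrating 1 + y \<le> exp y in the sub-Gaussian condition for a unit vector
    bounds the variance by K^2.\<close>
  have "ennreal (1 + Sg j j / K\<^sup>2) = ennreal (\<integral>v. 1 + v j * v j / K\<^sup>2 \<partial>\<mu>)"
    using cov_int[OF j j] by (simp add: cov j prob_space)
  also have "\<dots> = (\<integral>\<^sup>+v. ennreal (1 + v j * v j / K\<^sup>2) \<partial>\<mu>)"
    using cov_int[OF j j] by (intro nn_integral_eq_integral[symmetric]) auto
  also have "\<dots> \<le> (\<integral>\<^sup>+v. ennreal (exp ((\<Sum>k<p. ?e k * v k)\<^sup>2 / K\<^sup>2)) \<partial>\<mu>)"
    unfolding lin by (intro nn_integral_mono ennreal_leI) (simp add: power2_eq_square)
  also have "\<dots> \<le> ennreal 2" using subg[OF e1] by simp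
  finally have "1 + Sg j j / K\<^sup>2 \<le> 2" by (subst (asm) ennreal_le_iff) auto
  then show ?thesis using K0 by (simp add: field_simps)
qed

lemma Sg_psd: "0 \<le> bil p Sg u u"
  unfolding lin_prod_expectation[symmetric] by (rule integral_nonneg_AE) simp

lemma dev_eq:
  "bil p (dev n x Sg) u w = (\<Sum>r<n. (\<Sum>k<p. u k * x r k) * (\<Sum>l<p. w l * x r l)) / real n
     - expectation (\<lambda>v. (\<Sum>k<p. u k * v k) * (\<Sum>l<p. w l * v l))"
  by (simp only: bil_diff_matrix bil_Sigma_hat lin_prod_expectation)

lemma dev_event_measurable[measurable]:
  "{x \<in> space (data_measure n \<mu>). t \<le> \<bar>bil p (dev n x Sg) u w\<bar>} \<in> sets (data_measure n \<mu>)"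
proof -
  have [measurable]: "(\<lambda>x. \<Sum>k<p. u k * x r k) \<in> borel_measurable (PiM {..<n} (\<lambda>_. \<mu>))" if "r < n" for r u
    by (rule measurable_compose[of "\<lambda>x. x r" _ \<mu>]) (use that in \<open>auto intro: lin_measurable\<close>)
  show ?thesis unfolding dev_eq data_measure_def by measurable
qed

lemma data_prob_space: "prob_space (data_measure n \<mu>)"
  unfolding data_measure_def by (intro prob_space_PiM) (rule prob_space_axioms)

section \<open>Tail bounds and the events of high probability\<close>

lemma dev_tail:
  assumes "norm2 p u \<le> 1" "norm2 p w \<le> 1" "t > 0" "n \<ge> 1"
  shows "measure (data_measure n \<mu>) {x \<in> space (data_measure n \<mu>). t \<le> \<bar>bil p (dev n x Sg) u w\<bar>}
    \<le> 2 * exp (- real n * bernstein_exponent K t)"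
  unfolding dev_eq data_measure_def bernstein_exponent_def
  by (rule bernstein_iid[OF lin_prod_integrable _ lin_prod_subexponential]) (use assms K0 in auto)

lemma dev_tail_union:
  assumes I: "finite I" "\<And>i. i \<in> I \<Longrightarrow> norm2 p (U i) \<le> 1 \<and> norm2 p (W i) \<le> 1" and t: "t > 0" and n: "n \<ge> 1"
  shows "(\<Union>i\<in>I. {x \<in> space (data_measure n \<mu>). t \<le> \<bar>bil p (dev n x Sg) (U i) (W i)\<bar>}) \<in> sets (data_measure n \<mu>)"
    and "measure (data_measure n \<mu>) (\<Union>i\<in>I. {x \<in> space (data_measure n \<mu>). t \<le> \<bar>bil p (dev n x Sg) (U i) (W i)\<bar>})
      \<le> card I * (2 * exp (- real n * bernstein_exponent K t))"
proof -
  let ?E = "\<lambda>i. {x \<in> space (data_measure n \<mu>). t \<le> \<bar>bil p (dev n x Sg) (U i) (W i)\<bar>}"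
  show "(\<Union>i\<in>I. ?E i) \<in> sets (data_measure n \<mu>)"
    using I by (intro sets.finite_UN) (auto intro: dev_event_measurable)
  have "measure (data_measure n \<mu>) (\<Union>i\<in>I. ?E i) \<le> (\<Sum>i\<in>I. measure (data_measure n \<mu>) (?E i))"
    using I by (intro measure_UNION_le) (auto intro: dev_event_measurable)
  also have "\<dots> \<le> (\<Sum>i\<in>I. 2 * exp (- real n * bernstein_exponent K t))"
    using I t n by (intro sum_mono dev_tail) auto
  finally show "measure (data_measure n \<mu>) (\<Union>i\<in>I. ?E i) \<le> card I * (2 * exp (- real n * bernstein_exponent K t))"
    by simp
qed

lemma precision_pair:
  fixes L H :: real
  assumes p: "p \<ge> 1" and L: "L \<ge> 1" and H: "L \<le> H" "K\<^sup>2 \<le> H"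
    and inv: "\<And>i j. i < p \<Longrightarrow> j < p \<Longrightarrow> (\<Sum>k<p. Sg i k * Th k j) = (if i = j then 1 else 0)"
    and max: "lambda_max p Th \<le> L"
  shows "precision_pair p Sg Th H"
proof
  show "H \<ge> 1" using L H by simp
  show "Sg i j = Sg j i" if "i < p" "j < p" for i j using Sg_sym[OF that] .
  show "(\<Sum>k<p. Sg i k * Th k j) = (if i = j then 1 else 0)" if "i < p" "j < p" for i j using inv[OF that] .
  show "(norm2 p v)\<^sup>2 / H \<le> bil p Sg v v" for v
  proof -
    have "(norm2 p v)\<^sup>2 / H \<le> (norm2 p v)\<^sup>2 / L" using L H by (intro divide_left_mono) auto
    also have "\<dots> \<le> bil p Sg v v"
      by (rule inverse_rayleigh_lower[OF p _ Sg_sym Sg_psd inv max]) (use L in auto)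
    finally show ?thesis .
  qed
  show "Sg j j \<le> H" if "j < p" for j using Sg_diag_le[OF that] H by simp
qed

text \<open>The quadratic branch equals 8 \<tau>^2 \<rho>^2 and uses \<tau> \<ge> 1, the linear one
  equals 4 \<tau> \<rho> and uses \<rho> \<le> 1. At \<rho>^2 = log p / n the resulting tail is of
  order p to the power -4\<tau>, enough for a union over p^2 pairs.\<close>

lemma exponent_at_rate:
  assumes \<tau>: "\<tau> \<ge> 1" and \<rho>: "0 < \<rho>" "\<rho> \<le> 1"
  shows "4 * \<tau> * \<rho>\<^sup>2 \<le> bernstein_exponent K (16 * K\<^sup>2 * \<tau> * \<rho>)"
proof -
  have K2: "K\<^sup>2 > 0" using K0 by simp
  have "(16 * K\<^sup>2 * \<tau> * \<rho>)\<^sup>2 / (32 * (K\<^sup>2)\<^sup>2) = 8 * (\<tau> * \<tau>) * \<rho>\<^sup>2"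
    using K2 by (simp add: power_mult_distrib) (simp add: field_simps power2_eq_square)
  moreover have "8 * (\<tau> * 1) * \<rho>\<^sup>2 \<le> 8 * (\<tau> * \<tau>) * \<rho>\<^sup>2" using \<tau> by (intro mult_right_mono mult_left_mono) auto
  moreover have "0 \<le> \<tau> * \<rho>\<^sup>2" using \<tau> by simp
  ultimately have gauss: "4 * \<tau> * \<rho>\<^sup>2 \<le> (16 * K\<^sup>2 * \<tau> * \<rho>)\<^sup>2 / (32 * (K\<^sup>2)\<^sup>2)" by simp
  have "(16 * K\<^sup>2 * \<tau> * \<rho>) / (4 * K\<^sup>2) = 4 * \<tau> * \<rho>" using K2 by (simp add: field_simps)
  moreover have "4 * \<tau> * (\<rho> * \<rho>) \<le> 4 * \<tau> * (\<rho> * 1)" using \<tau> \<rho> by (intro mult_left_mono) auto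
  ultimately have "4 * \<tau> * \<rho>\<^sup>2 \<le> (16 * K\<^sup>2 * \<tau> * \<rho>) / (4 * K\<^sup>2)" by (simp add: power2_eq_square)
  with gauss show ?thesis unfolding bernstein_exponent_def by (rule min.boundedI)
qed

lemma net_card_bound:
  assumes "p \<ge> 2"
  shows "card (int_ball p (4 * (2 * s))) \<le> exp (24 * (s * ln p))"
proof -
  \<comment> \<open>The radius is 8s because the net serves 2s-sparse vectors; trading 3p for p^3
    turns the count into p to the power 24s.\<close>
  have "3 * p \<le> p ^ 3"
    using mult_mono[of 2 p 2 p] assms mult_le_mono[of 4 "p * p" p p] by (simp add: power3_eq_cube)
  then have "(3 * p) ^ (8 * s) \<le> (p ^ 3) ^ (8 * s)" by (rule power_mono) simp
  also have "\<dots> = p ^ (24 * s)" by (simp flip: power_mult)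
  finally have "card (int_ball p (4 * (2 * s))) \<le> p ^ (24 * s)"
    using int_ball_finite_card[of p "8 * s"] assms by simp
  then have "real (card (int_ball p (4 * (2 * s)))) \<le> real p ^ (24 * s)"
    by (metis of_nat_le_iff of_nat_power)
  also have "\<dots> = exp (24 * (s * ln p))"
    using assms exp_of_nat_mult[of "24 * s" "ln p"] by (simp add: mult.assoc)
  finally show ?thesis .
qed

lemma restricted_eigenvalue_event:
  fixes n s :: nat
  assumes "precision_pair p Sg Th H" and n: "n \<ge> 1" and p: "p \<ge> 2" and s: "s \<ge> 1" and \<tau>: "\<tau> \<ge> 1"
    and small: "48 * \<tau> * (s * ln p / n) \<le> bernstein_exponent K (1 / (100 * H))"
  obtains B where "B \<in> sets (data_measure n \<mu>)" "measure (data_measure n \<mu>) B \<le> 2 * p powr (- (4 * \<tau>))"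
    "\<And>x v. x \<in> space (data_measure n \<mu>) - B \<Longrightarrow> norm1 p v \<le> 4 * sqrt s * norm2 p v \<Longrightarrow>
        (norm2 p v)\<^sup>2 / (2 * H) \<le> bil p (Sigma_hat n x) v v"
proof -
  interpret precision_pair p Sg Th H by fact
  let ?z = "\<lambda>i k. 1 / (4 * sqrt (real (2 * s))) * real_of_int (i k)"
  define I where "I = {i \<in> int_ball p (4 * (2 * s)). norm2 p (?z i) \<le> 1}"
  \<comment> \<open>Passing from the net to 2s-sparse vectors doubles t to 1 / (50H), and the cone
    multiplies by (1 + 4)^2 = 25. The result 1 / (2H) is half of the population lower bound
    1/H.\<close>
  define t where "t = 1 / (100 * H)"
  define \<kappa> where "\<kappa> = bernstein_exponent K t"
  define B where "B = (\<Union>i\<in>I. {x \<in> space (data_measure n \<mu>). t \<le> \<bar>bil p (dev n x Sg) (?z i) (?z i)\<bar>})"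
  have fin: "finite (int_ball p (4 * (2 * s)))" using int_ball_finite_card p by simp
  have I: "finite I" "\<And>i. i \<in> I \<Longrightarrow> norm2 p (?z i) \<le> 1 \<and> norm2 p (?z i) \<le> 1"
    using fin by (auto simp: I_def)
  have t0: "t > 0" using H1 by (simp add: t_def)
  have B_sets: "B \<in> sets (data_measure n \<mu>)"
    and B_meas: "measure (data_measure n \<mu>) B \<le> card I * (2 * exp (- real n * \<kappa>))"
    unfolding B_def \<kappa>_def by (rule dev_tail_union[OF I t0 n]; assumption)+
  have ln0: "ln p > 0" using p by simp
  have \<kappa>1: "48 * \<tau> * (s * ln p) \<le> n * \<kappa>" using small n by (simp add: \<kappa>_def t_def field_simps)
  have "s * ln p * 1 \<le> s * ln p * \<tau>" using \<tau> ln0 by (intro mult_left_mono) auto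
  \<comment> \<open>One half of the exponent pays for the cardinality of the net; the other half
    leaves the decay 4 \<tau> log p.\<close>
  then have \<kappa>2: "24 * (s * ln p) \<le> n * \<kappa> / 2" using \<kappa>1 by (simp add: mult_ac)
  have "\<tau> * ln p * 1 \<le> \<tau> * ln p * s" using \<tau> ln0 s by (intro mult_left_mono) auto
  moreover have "0 \<le> \<tau> * ln p" using \<tau> ln0 by simp
  ultimately have "8 * (\<tau> * ln p) \<le> 48 * (\<tau> * ln p * s)" by linarith
  also have "\<dots> = 48 * \<tau> * (s * ln p)" by simp
  finally have \<kappa>3: "4 * \<tau> * ln p \<le> n * \<kappa> / 2" using \<kappa>1 by linarith
  have "real (card I) \<le> exp (24 * (s * ln p))"
    using net_card_bound[OF p, of s] card_mono[OF fin, of I] by (simp add: I_def)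
  then have "card I * (2 * exp (- real n * \<kappa>)) \<le> exp (24 * (s * ln p)) * (2 * exp (- real n * \<kappa>))"
    by (intro mult_right_mono) auto
  also have "\<dots> = 2 * exp (24 * (s * ln p) - n * \<kappa>)" by (simp flip: exp_add)
  also have "\<dots> \<le> 2 * exp (- (4 * \<tau>) * ln p)" using \<kappa>2 \<kappa>3 by simp
  also have "\<dots> = 2 * p powr (- (4 * \<tau>))" using p by (simp add: powr_def)
  finally have measB: "measure (data_measure n \<mu>) B \<le> 2 * p powr (- (4 * \<tau>))"
    using B_meas by linarith
  have RE: "(norm2 p v)\<^sup>2 / (2 * H) \<le> bil p (Sigma_hat n x) v v"
    if x: "x \<in> space (data_measure n \<mu>) - B" and cone: "norm1 p v \<le> 4 * sqrt s * norm2 p v" for x v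
  proof -
    have sym: "dev n x Sg k l = dev n x Sg l k" if "k < p" "l < p" for k l
      using Sg_sym[OF that] by (simp add: Sigma_hat_sym)
    have net: "\<bar>bil p (dev n x Sg) (?z i) (?z i)\<bar> \<le> 1 / (50 * H) / 2"
      if "i \<in> int_ball p (4 * (2 * s))" "norm2 p (?z i) \<le> 1" for i
    proof -
      have "i \<in> I" using that by (simp add: I_def)
      then have "\<bar>bil p (dev n x Sg) (?z i) (?z i)\<bar> < t" using x unfolding B_def by (auto simp: not_le)
      then show ?thesis by (simp add: t_def)
    qed
    have sp: "\<bar>bil p (dev n x Sg) w w\<bar> \<le> 1 / (50 * H) * (norm2 p w)\<^sup>2" if "card (supp p w) \<le> 2 * s" for w
      by (rule sparse_net_bound[where s = "2 * s", OF sym]) (use s net that in auto)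
    have "\<bar>bil p (dev n x Sg) v v\<bar> \<le> 1 / (50 * H) * (norm2 p v + norm1 p v / sqrt s)\<^sup>2"
      by (rule bil_sparse_to_all[OF sym s _ sp]) (use H1 in auto)
    also have "\<dots> \<le> 1 / (50 * H) * (5 * norm2 p v)\<^sup>2"
    proof (intro mult_left_mono power_mono)
      have "norm1 p v / sqrt s \<le> 4 * norm2 p v" using cone s by (simp add: field_simps)
      then show "norm2 p v + norm1 p v / sqrt s \<le> 5 * norm2 p v" by simp
    qed (use H1 in \<open>auto intro!: add_nonneg_nonneg divide_nonneg_nonneg sum_nonneg\<close>)
    also have "\<dots> = (norm2 p v)\<^sup>2 / (2 * H)" by (simp add: power_mult_distrib)
    finally have "\<bar>bil p (dev n x Sg) v v\<bar> \<le> (norm2 p v)\<^sup>2 / (2 * H)" .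
    moreover have "(norm2 p v)\<^sup>2 / H = (norm2 p v)\<^sup>2 / (2 * H) + (norm2 p v)\<^sup>2 / (2 * H)" by simp
    ultimately show ?thesis using Sg_lower[of v] unfolding bil_diff_matrix by linarith
  qed
  show ?thesis by (rule that[OF _ measB RE]) (rule B_sets)
qed

text \<open>Three bad sets: the entries of \<Delta> \<Theta>0, the entries of \<Theta>0' \<Delta>
  \<Theta>0, and the restricted eigenvalue condition. The first two are unions over p^2 pairs, and
  each set contributes at most 2 p^(2 - 4\<tau>).\<close>

lemma good_design_event:
  fixes n s :: nat
  assumes "precision_pair p Sg Th H" and n: "n \<ge> 1" and p: "p \<ge> 2" and s: "s \<ge> 1" and \<tau>: "\<tau> \<ge> 1"
    and sparse: "\<And>j. j < p \<Longrightarrow> card (supp p (\<lambda>k. Th k j)) \<le> s"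
    and small: "48 * \<tau> * (s * ln p / n) \<le> bernstein_exponent K (1 / (100 * H))" "s * ln p / n \<le> 1"
    and b: "b \<ge> 0"
  defines "\<rho> \<equiv> sqrt (ln p / n)" and "a \<equiv> 16 * H\<^sup>2 * K\<^sup>2 * \<tau>"
  assumes tau_small: "tau_rate H a b * (sqrt s * \<rho>) \<le> 1 / (2 * H)"
  obtains B where "B \<in> sets (data_measure n \<mu>)" "measure (data_measure n \<mu>) B \<le> 6 * p powr (2 - 4 * \<tau>)"
    "\<And>x. x \<in> space (data_measure n \<mu>) - B \<Longrightarrow> good_design p Sg Th H n s x a b \<rho> (sqrt s * \<rho>)"
proof -
  interpret precision_pair p Sg Th H by fact
  let ?M = "data_measure n \<mu>"
  interpret M: prob_space ?M by (rule data_prob_space)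
  have ln0: "ln p > 0" using p by simp
  have \<rho>0: "\<rho> > 0" using ln0 n by (simp add: \<rho>_def)
  have \<rho>2: "\<rho>\<^sup>2 = ln p / n" using ln0 by (simp add: \<rho>_def)
  have R2: "(sqrt s * \<rho>)\<^sup>2 \<le> 1" using small(2) by (simp add: power_mult_distrib \<rho>2)
  then have R1: "sqrt s * \<rho> \<le> 1" using power2_le_imp_le[of "sqrt s * \<rho>" 1] by simp
  have "1 * \<rho> \<le> sqrt s * \<rho>" using s \<rho>0 by (intro mult_right_mono) auto
  then have \<rho>1: "\<rho> \<le> 1" using R1 by simp
  define t where "t = 16 * K\<^sup>2 * \<tau> * \<rho>"
  have t0: "t > 0" using K0 \<tau> \<rho>0 by (simp add: t_def)
  define e where "e k l = (if l = k then 1 else 0 :: real)" for k l :: nat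
  \<comment> \<open>Columns have norm at most \<open>H\<close>, so they are normalised for the tail
    bound. Undoing this on both sides costs H^2, which is the factor in \<open>a\<close>.\<close>
  define \<eta> where "\<eta> j l = 1 / H * Th l j" for j l
  have e1: "norm2 p (e k) \<le> 1" for k
    by (simp add: L2_set_def e_def if_distrib[of "\<lambda>y. y\<^sup>2"] cong: if_cong)
  have \<eta>1: "norm2 p (\<eta> j) \<le> 1" if "j < p" for j
    unfolding \<eta>_def norm2_scale using Th_bounds(4)[OF that] H1 by simp
  let ?I = "{..<p} \<times> {..<p}"
  define B1 where "B1 = (\<Union>ij\<in>?I. {x \<in> space ?M. t \<le> \<bar>bil p (dev n x Sg) (e (fst ij)) (\<eta> (snd ij))\<bar>})"
  define B2 where "B2 = (\<Union>ij\<in>?I. {x \<in> space ?M. t \<le> \<bar>bil p (dev n x Sg) (\<eta> (fst ij)) (\<eta> (snd ij))\<bar>})"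
  have B1: "B1 \<in> sets ?M" "measure ?M B1 \<le> card ?I * (2 * exp (- real n * bernstein_exponent K t))"
    unfolding B1_def by (rule dev_tail_union; use e1 \<eta>1 t0 n in auto)+
  have B2: "B2 \<in> sets ?M" "measure ?M B2 \<le> card ?I * (2 * exp (- real n * bernstein_exponent K t))"
    unfolding B2_def by (rule dev_tail_union; use \<eta>1 t0 n in auto)+
  obtain B3 where B3: "B3 \<in> sets ?M" "measure ?M B3 \<le> 2 * p powr (- (4 * \<tau>))"
    "\<And>x v. x \<in> space ?M - B3 \<Longrightarrow> norm1 p v \<le> 4 * sqrt s * norm2 p v \<Longrightarrow>
        (norm2 p v)\<^sup>2 / (2 * H) \<le> bil p (Sigma_hat n x) v v"
    using restricted_eigenvalue_event[OF assms(1) n p s \<tau> small(1)] by blast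
  have "- real n * bernstein_exponent K t \<le> - real n * (4 * \<tau> * \<rho>\<^sup>2)"
    using exponent_at_rate[OF \<tau> \<rho>0 \<rho>1] by (simp add: t_def mult_left_mono)
  also have "\<dots> = - (4 * \<tau>) * ln p" using n by (simp add: \<rho>2)
  finally have "exp (- real n * bernstein_exponent K t) \<le> p powr (- (4 * \<tau>))"
    using p by (simp add: powr_def)
  then have "card ?I * (2 * exp (- real n * bernstein_exponent K t)) \<le> card ?I * (2 * p powr (- (4 * \<tau>)))"
    by (intro mult_left_mono) auto
  also have "\<dots> = 2 * (real p powr 2 * p powr (- (4 * \<tau>)))" using p by (simp add: card_cartesian_product power2_eq_square powr_numeral)
  also have "real p powr 2 * p powr (- (4 * \<tau>)) = p powr (2 - 4 * \<tau>)"
    unfolding powr_add[symmetric] by simp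
  finally have pairs: "card ?I * (2 * exp (- real n * bernstein_exponent K t)) \<le> 2 * p powr (2 - 4 * \<tau>)" .
  have "p powr (- (4 * \<tau>)) \<le> p powr (2 - 4 * \<tau>)" using p by (intro powr_mono) auto
  then have m3: "measure ?M B3 \<le> 2 * p powr (2 - 4 * \<tau>)" using B3(2) by linarith
  have "measure ?M (B1 \<union> B2 \<union> B3) \<le> measure ?M (B1 \<union> B2) + measure ?M B3"
    using B1 B2 B3 by (intro measure_Un_le) auto
  also have "measure ?M (B1 \<union> B2) \<le> measure ?M B1 + measure ?M B2"
    using B1 B2 by (intro measure_Un_le) auto
  finally have meas: "measure ?M (B1 \<union> B2 \<union> B3) \<le> 6 * p powr (2 - 4 * \<tau>)"
    using B1(2) B2(2) m3 pairs by linarith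
  have a\<rho>: "H\<^sup>2 * t = a * \<rho>" by (simp add: a_def t_def)
  have H2: "H \<le> H\<^sup>2" using H1 by (simp add: power2_eq_square)
  have good: "good_design p Sg Th H n s x a b \<rho> (sqrt s * \<rho>)" if x: "x \<in> space ?M - (B1 \<union> B2 \<union> B3)" for x
  proof unfold_locales
    show "s \<ge> 1" "b \<ge> 0" "\<rho> > 0" "sqrt s * \<rho> = sqrt s * \<rho>" by fact+ simp
    show "a \<ge> 0" using \<tau> by (simp add: a_def)
    show "card (supp p (\<lambda>k. Th k j)) \<le> s" if "j < p" for j by (rule sparse[OF that])
    show "(norm2 p v)\<^sup>2 / (2 * H) \<le> bil p (Sigma_hat n x) v v" if "norm1 p v \<le> 4 * sqrt s * norm2 p v" for v
      using B3(3) x that by simp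
    show "sqrt s * \<rho> \<le> 1" by fact
    show "tau_rate H a b * (sqrt s * \<rho>) \<le> 1 / (2 * H)" by fact
    show "\<bar>\<Sum>l<p. dev n x Sg k l * Th l j\<bar> \<le> a * \<rho>" if kj: "k < p" "j < p" for k j
    proof -
      have "\<bar>bil p (dev n x Sg) (e k) (\<eta> j)\<bar> < t"
        using x kj unfolding B1_def by (auto simp: not_le)
      moreover have "bil p (dev n x Sg) (e k) (\<eta> j) = (\<Sum>l<p. dev n x Sg k l * Th l j) / H"
        using kj by (simp add: bil_matrix_vector e_def \<eta>_def if_distrib[of "\<lambda>y. y * _"] sum_divide_distrib cong: if_cong)
      ultimately have "\<bar>\<Sum>l<p. dev n x Sg k l * Th l j\<bar> \<le> H * t" using H1 by (simp add: field_simps)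
      also have "\<dots> \<le> H\<^sup>2 * t" using H2 t0 by (intro mult_right_mono) auto
      finally show ?thesis by (simp add: a\<rho>)
    qed
    show "\<bar>bil p (dev n x Sg) (\<lambda>k. Th k i) (\<lambda>k. Th k j)\<bar> \<le> a * \<rho>" if ij: "i < p" "j < p" for i j
    proof -
      have "\<bar>bil p (dev n x Sg) (\<eta> i) (\<eta> j)\<bar> < t"
        using x ij unfolding B2_def by (auto simp: not_le)
      moreover have "bil p (dev n x Sg) (\<eta> i) (\<eta> j) = bil p (dev n x Sg) (\<lambda>k. Th k i) (\<lambda>k. Th k j) / H\<^sup>2"
        unfolding \<eta>_def bil_scale_left bil_scale_right by (simp add: power2_eq_square)
      ultimately have "\<bar>bil p (dev n x Sg) (\<lambda>k. Th k i) (\<lambda>k. Th k j)\<bar> \<le> H\<^sup>2 * t"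
        using H1 by (simp add: field_simps)
      then show ?thesis by (simp add: a\<rho>)
    qed
  qed
  show ?thesis by (rule that[OF _ meas good]) (use B1 B2 B3 in auto)
qed

text \<open>A single pair needs no union bound, so a level of order 1 / sqrt n suffices. At the
  chosen constant n times the two branches are 32 \<tau>^2 and 8 \<tau> sqrt n, both at least 8
  \<tau>.\<close>

lemma entry_event:
  fixes n i j :: nat
  assumes "precision_pair p Sg Th H" and n: "n \<ge> 1" and \<tau>: "\<tau> \<ge> 1" and ij: "i < p" "j < p"
  obtains B where "B \<in> sets (data_measure n \<mu>)" "measure (data_measure n \<mu>) B \<le> 2 * exp (- (8 * \<tau>))"
    "\<And>x. x \<in> space (data_measure n \<mu>) - B \<Longrightarrow>
      \<bar>bil p (dev n x Sg) (\<lambda>k. Th k i) (\<lambda>k. Th k j)\<bar> \<le> 32 * H\<^sup>2 * K\<^sup>2 * \<tau> * (1 / sqrt n)"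
proof -
  interpret precision_pair p Sg Th H by fact
  define t where "t = 32 * K\<^sup>2 * \<tau> * (1 / sqrt n)"
  have K2: "K\<^sup>2 > 0" using K0 by simp
  have t0: "t > 0" using K0 \<tau> n by (simp add: t_def)
  define \<eta> where "\<eta> j l = 1 / H * Th l j" for j l
  have \<eta>1: "norm2 p (\<eta> j) \<le> 1" if "j < p" for j
    unfolding \<eta>_def norm2_scale using Th_bounds(4)[OF that] H1 by simp
  let ?B = "{x \<in> space (data_measure n \<mu>). t \<le> \<bar>bil p (dev n x Sg) (\<eta> i) (\<eta> j)\<bar>}"
  have "8 * \<tau> \<le> n * bernstein_exponent K t"
  proof -
    have "n * (t\<^sup>2 / (32 * (K\<^sup>2)\<^sup>2)) = 32 * (\<tau> * \<tau>)"
      using n K2 by (simp add: t_def power_mult_distrib power_divide) (simp add: power2_eq_square)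
    moreover have "\<tau> * 1 \<le> \<tau> * \<tau>" using \<tau> by (intro mult_left_mono) auto
    moreover have "n * (t / (4 * K\<^sup>2)) = 8 * \<tau> * (n / sqrt n)" using K2 by (simp add: t_def)
    moreover have "n / sqrt n = sqrt n" by (rule real_div_sqrt) simp
    moreover have "8 * \<tau> * 1 \<le> 8 * \<tau> * sqrt n" using \<tau> n by (intro mult_left_mono) auto
    ultimately show ?thesis using \<tau> by (simp add: bernstein_exponent_def min_def)
  qed
  then have "2 * exp (- real n * bernstein_exponent K t) \<le> 2 * exp (- (8 * \<tau>))" by simp
  then have meas: "measure (data_measure n \<mu>) ?B \<le> 2 * exp (- (8 * \<tau>))"
    using dev_tail[OF \<eta>1[OF ij(1)] \<eta>1[OF ij(2)] t0 n] by linarith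
  have "\<bar>bil p (dev n x Sg) (\<lambda>k. Th k i) (\<lambda>k. Th k j)\<bar> \<le> 32 * H\<^sup>2 * K\<^sup>2 * \<tau> * (1 / sqrt n)"
    if x: "x \<in> space (data_measure n \<mu>) - ?B" for x
  proof -
    have "\<bar>bil p (dev n x Sg) (\<eta> i) (\<eta> j)\<bar> < t" using x by (auto simp: not_le)
    moreover have "bil p (dev n x Sg) (\<eta> i) (\<eta> j) = bil p (dev n x Sg) (\<lambda>k. Th k i) (\<lambda>k. Th k j) / H\<^sup>2"
      unfolding \<eta>_def bil_scale_left bil_scale_right by (simp add: power2_eq_square)
    ultimately have "\<bar>bil p (dev n x Sg) (\<lambda>k. Th k i) (\<lambda>k. Th k j)\<bar> \<le> H\<^sup>2 * t"
      using H1 by (simp add: field_simps)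
    then show ?thesis by (simp add: t_def mult_ac)
  qed
  then show ?thesis by (rule that[OF dev_event_measurable meas])
qed

end

section \<open>Assembly of the two probability bounds\<close>

lemma (in prob_space) outer_prob_le_trivial:
  assumes "A \<subseteq> space M" "1 \<le> r"
  shows "outer_prob_le M A r"
  unfolding outer_prob_le_def using assms by (intro bexI[of _ "space M"]) (auto simp: prob_space)

lemma bernstein_exponent_pos: "K > 0 \<Longrightarrow> t > 0 \<Longrightarrow> 0 < bernstein_exponent K t"
  by (simp add: bernstein_exponent_def)

lemma max_abs_norm_ge_imp:
  assumes "p \<ge> 1" "c \<le> max_abs_norm p A"
  shows "\<exists>i<p. \<exists>j<p. c \<le> \<bar>A i j\<bar>"
proof -
  let ?S = "{\<bar>A i j\<bar> | i j. i < p \<and> j < p}"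
  have "?S = (\<lambda>(i, j). \<bar>A i j\<bar>) ` ({..<p} \<times> {..<p})" by auto
  then have "finite ?S" by simp
  moreover have "?S \<noteq> {}" using assms(1) by (auto intro!: exI[of _ "0::nat"])
  ultimately have "Max ?S \<in> ?S" by (rule Max_in)
  then obtain i j where "i < p" "j < p" "Max ?S = \<bar>A i j\<bar>" by blast
  then show ?thesis using assms(2) unfolding max_abs_norm_def by (metis (lifting))
qed

text \<open>The threshold \<open>\<delta>\<close> expresses that s log p / n tends to 0, uniformly
  in all other data. The multiple \<open>c'\<close> fixes the order of the penalties from above,
  since larger penalties bias the estimator more; \<open>C\<tau>\<close> and \<open>\<delta>\<close>
  may depend on it. Outer probability allows for a nonmeasurable choice of minimisers.\<close>

theorem theorem2:
  fixes K L :: real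
  assumes "K > 0" and "L \<ge> 1"
  shows "\<exists>c0>0. \<forall>c'\<ge>c0. \<exists>c1>0. \<exists>c2>0. \<forall>\<tau>>0. \<exists>C\<tau>>0. \<exists>\<delta>>0.
    \<forall>(n::nat) (p::nat) (s::nat) (\<Theta>0::nat \<Rightarrow> nat \<Rightarrow> real) (\<Sigma>0::nat \<Rightarrow> nat \<Rightarrow> real)
      (\<mu>::(nat \<Rightarrow> real) measure) (lam::nat \<Rightarrow> real) (g::(nat \<Rightarrow> nat \<Rightarrow> real) \<Rightarrow> nat \<Rightarrow> nat \<Rightarrow> real).
      n \<ge> 1 \<and> p \<ge> 2 \<and> real s * ln (real p) / real n \<le> \<delta>
      \<and> in_G p L s \<Theta>0
      \<and> (\<forall>i<p. \<forall>j<p. (\<Sum>k<p. \<Sigma>0 i k * \<Theta>0 k j) = (if i = j then 1 else 0))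
      \<and> prob_space \<mu> \<and> sets \<mu> = sets (PiM {..<p} (\<lambda>_. (borel :: real measure)))
      \<and> (\<forall>j<p. integrable \<mu> (\<lambda>v. v j) \<and> (\<integral>v. v j \<partial>\<mu>) = 0)
      \<and> (\<forall>a<p. \<forall>b<p. integrable \<mu> (\<lambda>v. v a * v b) \<and> (\<integral>v. v a * v b \<partial>\<mu>) = \<Sigma>0 a b)
      \<and> (\<forall>\<alpha>::nat \<Rightarrow> real. (\<Sum>j<p. (\<alpha> j)\<^sup>2) \<le> 1 \<longrightarrow>
           (\<integral>\<^sup>+v. ennreal (exp ((\<Sum>j<p. \<alpha> j * v j)\<^sup>2 / K\<^sup>2)) \<partial>\<mu>) \<le> 2)
      \<and> (\<forall>j<p. c0 * \<tau> * sqrt (ln (real p) / real n) \<le> lam j \<and> lam j \<le> c' * \<tau> * sqrt (ln (real p) / real n))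
      \<and> (\<forall>x\<in>space (data_measure n \<mu>). \<forall>j<p. is_nodewise_lasso n p x j (lam j) (g x j))
      \<longrightarrow>
      (\<forall>i<p. \<forall>j<p. outer_prob_le (data_measure n \<mu>)
          {x \<in> space (data_measure n \<mu>).
             \<bar>T_hat n p x lam (g x) i j - \<Theta>0 i j\<bar> \<ge> C\<tau> * max (1 / sqrt (real n)) (real s * ln (real p) / real n)}
          (c1 * exp (- c2 * \<tau>)))
      \<and> outer_prob_le (data_measure n \<mu>)
          {x \<in> space (data_measure n \<mu>).
             max_abs_norm p (\<lambda>a b. T_hat n p x lam (g x) a b - \<Theta>0 a b)
               \<ge> C\<tau> * max (sqrt (ln (real p) / real n)) (real s * ln (real p) / real n)}
          (c1 * real p powr (1 - c2 * \<tau>))"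
proof -
  define H where "H = L + K\<^sup>2"
  have H: "H \<ge> 1" "L \<le> H" "K\<^sup>2 \<le> H" using assms by (auto simp: H_def add_increasing2)
  \<comment> \<open>Chosen such that c0 \<tau> = 2 H a, the noise level that a penalty has to
    dominate in \<open>cross_term\<close>.\<close>
  define c0 where "c0 = 32 * H ^ 3 * K\<^sup>2"
  have c0: "c0 > 0" using H assms by (simp add: c0_def)
  have main: "\<exists>C\<tau>>0. \<exists>\<delta>>0.
    \<forall>(n::nat) (p::nat) (s::nat) (\<Theta>0::nat \<Rightarrow> nat \<Rightarrow> real) (\<Sigma>0::nat \<Rightarrow> nat \<Rightarrow> real)
      (\<mu>::(nat \<Rightarrow> real) measure) (lam::nat \<Rightarrow> real) (g::(nat \<Rightarrow> nat \<Rightarrow> real) \<Rightarrow> nat \<Rightarrow> nat \<Rightarrow> real).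
      n \<ge> 1 \<and> p \<ge> 2 \<and> real s * ln (real p) / real n \<le> \<delta>
      \<and> in_G p L s \<Theta>0
      \<and> (\<forall>i<p. \<forall>j<p. (\<Sum>k<p. \<Sigma>0 i k * \<Theta>0 k j) = (if i = j then 1 else 0))
      \<and> prob_space \<mu> \<and> sets \<mu> = sets (PiM {..<p} (\<lambda>_. (borel :: real measure)))
      \<and> (\<forall>j<p. integrable \<mu> (\<lambda>v. v j) \<and> (\<integral>v. v j \<partial>\<mu>) = 0)
      \<and> (\<forall>a<p. \<forall>b<p. integrable \<mu> (\<lambda>v. v a * v b) \<and> (\<integral>v. v a * v b \<partial>\<mu>) = \<Sigma>0 a b)
      \<and> (\<forall>\<alpha>::nat \<Rightarrow> real. (\<Sum>j<p. (\<alpha> j)\<^sup>2) \<le> 1 \<longrightarrow>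
           (\<integral>\<^sup>+v. ennreal (exp ((\<Sum>j<p. \<alpha> j * v j)\<^sup>2 / K\<^sup>2)) \<partial>\<mu>) \<le> 2)
      \<and> (\<forall>j<p. c0 * \<tau> * sqrt (ln (real p) / real n) \<le> lam j \<and> lam j \<le> c' * \<tau> * sqrt (ln (real p) / real n))
      \<and> (\<forall>x\<in>space (data_measure n \<mu>). \<forall>j<p. is_nodewise_lasso n p x j (lam j) (g x j))
      \<longrightarrow>
      (\<forall>i<p. \<forall>j<p. outer_prob_le (data_measure n \<mu>)
          {x \<in> space (data_measure n \<mu>).
             \<bar>T_hat n p x lam (g x) i j - \<Theta>0 i j\<bar> \<ge> C\<tau> * max (1 / sqrt (real n)) (real s * ln (real p) / real n)}
          (8 * exp (- 1 * \<tau>)))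
      \<and> outer_prob_le (data_measure n \<mu>)
          {x \<in> space (data_measure n \<mu>).
             max_abs_norm p (\<lambda>a b. T_hat n p x lam (g x) a b - \<Theta>0 a b)
               \<ge> C\<tau> * max (sqrt (ln (real p) / real n)) (real s * ln (real p) / real n)}
          (8 * real p powr (1 - 1 * \<tau>))" if c': "c' \<ge> c0" and \<tau>: "\<tau> > 0" for c' \<tau>
  proof (cases "\<tau> < 1")
    case True
    have "exp 1 \<le> (3::real)" by (rule exp_le)
    moreover have "exp \<tau> \<le> exp (1::real)" using True by simp
    ultimately have "exp \<tau> \<le> 8" by linarith
    then have triv1: "1 \<le> 8 * exp (- 1 * \<tau>)" by (simp add: exp_minus field_simps)
    have triv2: "1 \<le> 8 * real p powr (1 - 1 * \<tau>)" if "p \<ge> 2" for p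
      using True that ge_one_powr_ge_zero[of "real p" "1 - \<tau>"] by simp
    have ps: "prob_space (data_measure n \<mu>)" if "prob_space \<mu>" for n and \<mu> :: "(nat \<Rightarrow> real) measure"
      unfolding data_measure_def using that by (intro prob_space_PiM)
    show ?thesis
      by (intro exI[of _ "1::real"] conjI allI impI)
        (auto intro!: prob_space.outer_prob_le_trivial[OF ps] triv1[simplified] triv2[simplified])
  next
    case False
    then have \<tau>1: "\<tau> \<ge> 1" by simp
    define a where "a = 16 * H\<^sup>2 * K\<^sup>2 * \<tau>"
    define b where "b = c' * \<tau>"
    define E where "E = tau_rate H a b"
    define M where "M = 2 * a * l1_rate H a b + pred_rate H a b"
    \<comment> \<open>The first summand covers the leading term of either bound, \<open>M\<close>
      the remainder; the summand 1 makes the final comparison strict, as the bad events are defined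
      by a weak inequality.\<close>
    define C where "C = 32 * H\<^sup>2 * K\<^sup>2 * \<tau> + M + 1"
    define \<kappa> where "\<kappa> = bernstein_exponent K (1 / (100 * H))"
    \<comment> \<open>The three entries yield, in this order, R \<le> 1, the bound
      \<open>tau_small\<close>, and room for the entropy of the net.\<close>
    define \<delta> where "\<delta> = min 1 (min ((1 / (2 * H * E))\<^sup>2) (\<kappa> / (48 * \<tau>)))"
    have a0: "a \<ge> 0" and b0: "b > 0" using \<tau> c' c0 by (auto simp: a_def b_def)
    have E0: "E > 0" using a0 b0 H unfolding E_def tau_rate_def by (intro add_nonneg_pos add_nonneg_nonneg) auto
    have M0: "M \<ge> 0"
      using a0 b0 H E0 by (simp add: M_def l1_rate_def pred_rate_def E_def[symmetric])
    have C0: "C > 0" using M0 \<tau> by (simp add: C_def add_nonneg_pos)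
    have \<delta>0: "\<delta> > 0"
      using bernstein_exponent_pos[of K "1 / (100 * H)"] assms H E0 \<tau> by (simp add: \<delta>_def \<kappa>_def)
    show ?thesis
    proof (rule exI[of _ C], rule conjI[OF C0], rule exI[of _ \<delta>], rule conjI[OF \<delta>0],
        intro allI impI, elim conjE, intro conjI allI impI)
      fix n p s :: nat and \<Theta>0 \<Sigma>0 :: "nat \<Rightarrow> nat \<Rightarrow> real" and \<mu> :: "(nat \<Rightarrow> real) measure"
        and lam :: "nat \<Rightarrow> real" and g :: "(nat \<Rightarrow> nat \<Rightarrow> real) \<Rightarrow> nat \<Rightarrow> nat \<Rightarrow> real"
      assume n: "n \<ge> 1" and p: "p \<ge> 2" and small: "real s * ln (real p) / real n \<le> \<delta>"
        and G: "in_G p L s \<Theta>0"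
        and inv: "\<forall>i<p. \<forall>j<p. (\<Sum>k<p. \<Sigma>0 i k * \<Theta>0 k j) = (if i = j then 1 else 0)"
        and \<mu>: "prob_space \<mu>" "sets \<mu> = sets (PiM {..<p} (\<lambda>_. (borel :: real measure)))"
        and cov: "\<forall>a<p. \<forall>b<p. integrable \<mu> (\<lambda>v. v a * v b) \<and> (\<integral>v. v a * v b \<partial>\<mu>) = \<Sigma>0 a b"
        and subg: "\<forall>\<alpha>::nat \<Rightarrow> real. (\<Sum>j<p. (\<alpha> j)\<^sup>2) \<le> 1 \<longrightarrow>
           (\<integral>\<^sup>+v. ennreal (exp ((\<Sum>j<p. \<alpha> j * v j)\<^sup>2 / K\<^sup>2)) \<partial>\<mu>) \<le> 2"
        and lam: "\<forall>j<p. c0 * \<tau> * sqrt (ln (real p) / real n) \<le> lam j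
            \<and> lam j \<le> c' * \<tau> * sqrt (ln (real p) / real n)"
        and lasso: "\<forall>x\<in>space (data_measure n \<mu>). \<forall>j<p. is_nodewise_lasso n p x j (lam j) (g x j)"
      let ?D = "data_measure n \<mu>"
      interpret prob_space \<mu> by fact
      interpret subgaussian_rows \<mu> p K \<Sigma>0
      proof unfold_locales
        show "(\<integral>\<^sup>+v. ennreal (exp ((\<Sum>j<p. u j * v j)\<^sup>2 / K\<^sup>2)) \<partial>\<mu>) \<le> 2" if "norm2 p u \<le> 1" for u
        proof -
          have "(norm2 p u)\<^sup>2 \<le> 1" using that by (simp add: power_le_one)
          then show ?thesis using subg by (simp add: norm2_sq)
        qed
      qed (use assms \<mu> cov in auto)
      have pp: "precision_pair p \<Sigma>0 \<Theta>0 H"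
        by (rule precision_pair[of L]) (use p assms H inv G in \<open>auto simp: in_G_def\<close>)
      have sparse: "card (supp p (\<lambda>k. \<Theta>0 k j)) \<le> s" if "j < p" for j
        using G that by (simp add: in_G_def)
      \<comment> \<open>For s = 0 the first column of \<open>\<Theta>0\<close> would vanish, against
        the inverse relation at (0,0).\<close>
      have s: "s \<ge> 1"
      proof (rule ccontr)
        assume "\<not> s \<ge> 1"
        moreover have "0 < p" using p by simp
        note sparse[OF this]
        ultimately have "card (supp p (\<lambda>k. \<Theta>0 k 0)) = 0" by linarith
        then have "supp p (\<lambda>k. \<Theta>0 k 0) = {}" by (subst (asm) card_0_eq) auto
        then have "\<forall>k<p. \<Theta>0 k 0 = 0" by blast
        then show False using inv[rule_format, of 0 0] p by simp
      qed
      define X where "X = real s * ln (real p) / real n"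
      define \<rho> where "\<rho> = sqrt (ln p / n)"
      have ln0: "ln (real p) > 0" using p by simp
      have X0: "X > 0" using ln0 n s by (simp add: X_def)
      have \<rho>0: "\<rho> > 0" and X: "s * \<rho>\<^sup>2 = X" using ln0 n by (simp_all add: \<rho>_def X_def)
      have R: "sqrt s * \<rho> = sqrt X" by (simp add: \<rho>_def X_def flip: real_sqrt_mult)
      have X\<delta>: "X \<le> 1" "X \<le> (1 / (2 * H * E))\<^sup>2" "X \<le> \<kappa> / (48 * \<tau>)"
        using small by (auto simp: X_def \<delta>_def)
      have sm1: "48 * \<tau> * (s * ln p / n) \<le> bernstein_exponent K (1 / (100 * H))"
      proof -
        have "X * (48 * \<tau>) \<le> \<kappa>" using X\<delta>(3) \<tau> by (subst (asm) pos_le_divide_eq) auto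
        then show ?thesis unfolding \<kappa>_def X_def by (simp only: mult_ac times_divide_eq_right)
      qed
      have sm2: "s * ln p / n \<le> 1" using X\<delta>(1) by (simp add: X_def)
      have "sqrt X \<le> sqrt ((1 / (2 * H * E))\<^sup>2)" using X\<delta>(2) by (rule real_sqrt_le_mono)
      also have "\<dots> = 1 / (2 * H * E)" using H E0 by (intro real_sqrt_abs[THEN trans]) simp
      finally have "E * sqrt X \<le> E * (1 / (2 * H * E))" using E0 by (intro mult_left_mono) auto
      then have sm3: "tau_rate H a b * (sqrt s * \<rho>) \<le> 1 / (2 * H)"
        unfolding R E_def[symmetric] using E0 by simp
      obtain B where B: "B \<in> sets ?D" "measure ?D B \<le> 6 * p powr (2 - 4 * \<tau>)"
        "\<And>x. x \<in> space ?D - B \<Longrightarrow> good_design p \<Sigma>0 \<Theta>0 H n s x a b \<rho> (sqrt s * \<rho>)"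
        using good_design_event[OF pp n p s \<tau>1 sparse sm1 sm2 less_imp_le[OF b0],
            folded \<rho>_def, folded a_def, OF _ sm3] by blast
      have expansion: "\<bar>T_hat n p x lam (g x) i j - \<Theta>0 i j + bil p (dev n x \<Sigma>0) (\<lambda>k. \<Theta>0 k i) (\<lambda>k. \<Theta>0 k j)\<bar> \<le> M * X"
        if x: "x \<in> space ?D - B" and ij: "i < p" "j < p" for x i j
      proof -
        interpret good_design p \<Sigma>0 \<Theta>0 H n s x a b \<rho> "sqrt s * \<rho>" by (rule B(3)[OF x])
        have "2 * H * a * \<rho> = c0 * \<tau> * \<rho>"
          by (simp add: a_def c0_def power2_eq_square power3_eq_cube)
        moreover have "0 < c0 * \<tau> * \<rho>" using c0 \<tau> \<rho>0 by simp
        ultimately have "2 * H * a * \<rho> \<le> lam j" "lam j \<le> b * \<rho>" "lam j > 0" if "j < p" for j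
          using lam that by (auto simp: b_def \<rho>_def intro: less_le_trans)
        then show ?thesis
          using T_hat_expansion[OF ij, of lam "g x"] lasso x unfolding M_def X by auto
      qed
      \<comment> \<open>The same bad set \<open>B\<close> serves both bounds. The second inequality
        needs only ln p \<ge> 1/2, since (2 - 4\<tau>) / 2 = 1 - 2\<tau> \<le> - \<tau> for \<tau>
        \<ge> 1.\<close>
      have powr_bound: "p powr (2 - 4 * \<tau>) \<le> p powr (1 - \<tau>)" "p powr (2 - 4 * \<tau>) \<le> exp (- \<tau>)"
      proof -
        show "p powr (2 - 4 * \<tau>) \<le> p powr (1 - \<tau>)" using p \<tau>1 by (intro powr_mono) auto
        have "ln 2 \<le> ln (real p)" using p by simp
        then have "1 / 2 \<le> ln (real p)" using ln2_ge_two_thirds by linarith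
        then have "(4 * \<tau> - 2) * (1 / 2) \<le> (4 * \<tau> - 2) * ln p" using \<tau>1 by (intro mult_left_mono) auto
        then have "(2 - 4 * \<tau>) * ln p \<le> - \<tau>" using \<tau>1 by (simp add: algebra_simps)
        then show "p powr (2 - 4 * \<tau>) \<le> exp (- \<tau>)" using p by (simp add: powr_def)
      qed
      show "outer_prob_le ?D {x \<in> space ?D. \<bar>T_hat n p x lam (g x) i j - \<Theta>0 i j\<bar>
            \<ge> C * max (1 / sqrt (real n)) (real s * ln (real p) / real n)} (8 * exp (- 1 * \<tau>))"
        if ij: "i < p" "j < p" for i j
      proof -
        let ?m = "max (1 / sqrt (real n)) X"
        obtain B' where B': "B' \<in> sets ?D" "measure ?D B' \<le> 2 * exp (- (8 * \<tau>))"
          "\<And>x. x \<in> space ?D - B' \<Longrightarrow>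
            \<bar>bil p (dev n x \<Sigma>0) (\<lambda>k. \<Theta>0 k i) (\<lambda>k. \<Theta>0 k j)\<bar> \<le> 32 * H\<^sup>2 * K\<^sup>2 * \<tau> * (1 / sqrt n)"
          using entry_event[OF pp n \<tau>1 ij] by blast
        have "x \<in> B \<union> B'" if x: "x \<in> space ?D" and big: "C * ?m \<le> \<bar>T_hat n p x lam (g x) i j - \<Theta>0 i j\<bar>" for x
        proof (rule ccontr)
          assume "x \<notin> B \<union> B'"
          then have xB: "x \<in> space ?D - B" "x \<in> space ?D - B'" using x by auto
          have "\<bar>T_hat n p x lam (g x) i j - \<Theta>0 i j\<bar> \<le> 32 * H\<^sup>2 * K\<^sup>2 * \<tau> * (1 / sqrt n) + M * X"
            using expansion[OF xB(1) ij] B'(3)[OF xB(2)] by linarith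
          also have "\<dots> \<le> 32 * H\<^sup>2 * K\<^sup>2 * \<tau> * ?m + M * ?m"
            using M0 \<tau> by (intro add_mono mult_left_mono) auto
          also have "\<dots> < C * ?m" using X0 by (simp add: C_def distrib_right less_max_iff_disj)
          finally show False using big by simp
        qed
        then have sub: "{x \<in> space ?D. \<bar>T_hat n p x lam (g x) i j - \<Theta>0 i j\<bar>
            \<ge> C * max (1 / sqrt (real n)) (real s * ln (real p) / real n)} \<subseteq> B \<union> B'"
          unfolding X_def by auto
        have "measure ?D (B \<union> B') \<le> measure ?D B + measure ?D B'" by (rule measure_Un_le[OF B(1) B'(1)])
        also have "\<dots> \<le> 6 * exp (- \<tau>) + 2 * exp (- \<tau>)"
        proof (rule add_mono)
          show "measure ?D B \<le> 6 * exp (- \<tau>)" using B(2) powr_bound(2) by linarith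
          have "exp (- (8 * \<tau>)) \<le> exp (- \<tau>)" using \<tau> by simp
          then show "measure ?D B' \<le> 2 * exp (- \<tau>)" using B'(2) by linarith
        qed
        finally have "measure ?D (B \<union> B') \<le> 8 * exp (- 1 * \<tau>)" by simp
        then show ?thesis
          unfolding outer_prob_le_def using sub B(1) B'(1) by (intro bexI[of _ "B \<union> B'"]) auto
      qed
      show "outer_prob_le ?D {x \<in> space ?D. max_abs_norm p (\<lambda>a b. T_hat n p x lam (g x) a b - \<Theta>0 a b)
            \<ge> C * max (sqrt (ln (real p) / real n)) (real s * ln (real p) / real n)} (8 * real p powr (1 - 1 * \<tau>))"
      proof -
        let ?m = "max \<rho> X"
        have "x \<in> B" if x: "x \<in> space ?D"
          and big: "C * ?m \<le> max_abs_norm p (\<lambda>a b. T_hat n p x lam (g x) a b - \<Theta>0 a b)" for x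
        proof (rule ccontr)
          assume "x \<notin> B"
          then have xB: "x \<in> space ?D - B" using x by auto
          interpret good_design p \<Sigma>0 \<Theta>0 H n s x a b \<rho> "sqrt s * \<rho>" by (rule B(3)[OF xB])
          obtain i j where ij: "i < p" "j < p" "C * ?m \<le> \<bar>T_hat n p x lam (g x) i j - \<Theta>0 i j\<bar>"
            using max_abs_norm_ge_imp[OF _ big] p by auto
          have "\<bar>T_hat n p x lam (g x) i j - \<Theta>0 i j\<bar> \<le> a * \<rho> + M * X"
            \<comment> \<open>For the maximum the leading term is already controlled for all pairs
              by \<open>dev_quad\<close>, so \<open>B\<close> alone suffices.\<close>
            using expansion[OF xB ij(1,2)] dev_quad[OF ij(1,2)] by linarith
          also have "\<dots> \<le> 32 * H\<^sup>2 * K\<^sup>2 * \<tau> * ?m + M * ?m"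
            using M0 \<tau> \<rho>0 by (intro add_mono mult_left_mono mult_mono) (auto simp: a_def)
          also have "\<dots> < C * ?m" using X0 by (simp add: C_def distrib_right less_max_iff_disj)
          finally show False using ij(3) by simp
        qed
        then have sub: "{x \<in> space ?D. max_abs_norm p (\<lambda>a b. T_hat n p x lam (g x) a b - \<Theta>0 a b)
            \<ge> C * max (sqrt (ln (real p) / real n)) (real s * ln (real p) / real n)} \<subseteq> B"
          unfolding X_def \<rho>_def by auto
        have "0 \<le> p powr (1 - \<tau>)" by simp
        then have "measure ?D B \<le> 8 * p powr (1 - \<tau>)" using B(2) powr_bound(1) by linarith
        then show ?thesis
          unfolding outer_prob_le_def using sub B(1) by (intro bexI[of _ B]) auto
      qed
    qed
  qed
  show ?thesis
    by (rule exI[of _ c0], rule conjI[OF c0], intro allI impI, rule exI[of _ 8], rule conjI, simp,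
      rule exI[of _ 1], rule conjI, simp, intro allI impI, rule main)
qed

end
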